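(* Let $n,k,l$ be positive integers with $\gcd(k,l)=1$, $n\nmid k$ and $n\nmid l$. Then the number $\tau_{k,l}(n)$ of spanning trees of the $I$-graph $I(n,k,l)$ is given by $$\tau_{k,l}(n)=(-1)^{(n-1)(k+l)}\,n\prod_{s=1}^{k+l-1}\frac{T_n(w_s)-1}{w_s-1},$$ where $w_1,\dots,w_{k+l-1}\in\mathbb{C}$ are the roots, counted with multiplicity, of the algebraic equation of degree $k+l-1$ $$\frac{(3-2T_k(w))(3-2T_l(w))-1}{w-1}=0,$$ and $T_j$ denotes the Chebyshev polynomial of the first kind of degree $j$.
   Context: The $I$-graph $I(n,k,l)$ is the multigraph with vertex set $\{u_i,v_i : i\in\mathbb{Z}/n\}$ and with edges $u_iu_{i+l}$, $u_iv_i$, $v_iv_{i+k}$, one of each kind for every $i\in\mathbb{Z}/n$ (subscripts modulo $n$; $3n$ edges in total). Multiple edges are allowed (parallel edges are distinguished when counting spanning trees), and the graph is $3$-valent; the conditions $n\nmid k$, $n\nmid l$ say there are no loops. The Chebyshev polynomial of the first kind $T_j$ is determined by $T_j(\cos\varphi)=\cos(j\varphi)$. *)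

theory Defs
  imports Complex_Main "HOL-Computational_Algebra.Computational_Algebra"
begin

section \<open>Undirected multigraphs and their spanning trees\<close>

text \<open>
  Edges are labels, and \<open>ends G e\<close> is the set of endpoints of \<open>e\<close> (a singleton if \<open>e\<close> is a
  loop). Parallel edges are different labels with the same endpoints.
\<close>

record ('v, 'e) multigraph =
  verts :: "'v set"
  edges :: "'e set"
  ends :: "'e \<Rightarrow> 'v set"

definition adjacent :: "('v, 'e) multigraph \<Rightarrow> ('v \<times> 'v) set" where
  "adjacent G = {(x, y). \<exists>e \<in> edges G. ends G e = {x, y}}"

definition connected_graph :: "('v, 'e) multigraph \<Rightarrow> bool" where
  "connected_graph G \<longleftrightarrow> verts G \<noteq> {} \<and> (\<forall>x \<in> verts G. \<forall>y \<in> verts G. (x, y) \<in> (adjacent G)\<^sup>*)"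

text \<open>
  A cycle visits the distinct vertices \<open>xs\<close> cyclically, the \<open>i\<close>-th edge of \<open>es\<close> joining the
  \<open>i\<close>-th vertex to the next one. A loop is a cycle of length 1; two parallel edges form a
  cycle of length 2.
\<close>

definition is_cycle :: "('v, 'e) multigraph \<Rightarrow> 'v list \<Rightarrow> 'e list \<Rightarrow> bool" where
  "is_cycle G xs es \<longleftrightarrow>
     xs \<noteq> [] \<and> length es = length xs \<and> distinct xs \<and> distinct es \<and>
     set xs \<subseteq> verts G \<and> set es \<subseteq> edges G \<and>
     (\<forall>i < length xs. ends G (es ! i) = {xs ! i, xs ! (Suc i mod length xs)})"

definition is_tree :: "('v, 'e) multigraph \<Rightarrow> bool" where
  "is_tree G \<longleftrightarrow> connected_graph G \<and> \<not> (\<exists>xs es. is_cycle G xs es)"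

text \<open>A spanning tree contains all vertices, so it is identified with its edge set.\<close>

definition spanning_trees :: "('v, 'e) multigraph \<Rightarrow> 'e set set" where
  "spanning_trees G = {F. F \<subseteq> edges G \<and> is_tree (G\<lparr>edges := F\<rparr>)}"

definition num_spanning_trees :: "('v, 'e) multigraph \<Rightarrow> nat" where
  "num_spanning_trees G = card (spanning_trees G)"


section \<open>I-graphs\<close>

text \<open>The index set of integers modulo \<open>n\<close> is represented by \<open>{..<n}\<close>.\<close>

datatype I_vertex = U nat | V nat

datatype I_edge = UU nat | UV nat | VV nat

fun I_ends :: "nat \<Rightarrow> nat \<Rightarrow> nat \<Rightarrow> I_edge \<Rightarrow> I_vertex set" where
  "I_ends n k l (UU i) = {U i, U ((i + l) mod n)}"
| "I_ends n k l (UV i) = {U i, V i}"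
| "I_ends n k l (VV i) = {V i, V ((i + k) mod n)}"

definition I_graph :: "nat \<Rightarrow> nat \<Rightarrow> nat \<Rightarrow> (I_vertex, I_edge) multigraph" where
  "I_graph n k l =
     \<lparr>verts = U ` {..<n} \<union> V ` {..<n},
      edges = UU ` {..<n} \<union> UV ` {..<n} \<union> VV ` {..<n},
      ends = I_ends n k l\<rparr>"


section \<open>Chebyshev polynomials of the first kind\<close>

definition cheb :: "nat \<Rightarrow> complex poly" where
  "cheb j = (THE p. \<forall>\<phi>::real. poly p (of_real (cos \<phi>)) = of_real (cos (real j * \<phi>)))"

lemma cheb_unique:
  fixes p q :: "complex poly"
  assumes p: "\<And>\<phi>::real. poly p (of_real (cos \<phi>)) = c \<phi>"
    and q: "\<And>\<phi>::real. poly q (of_real (cos \<phi>)) = c \<phi>"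
  shows "p = q"
proof (rule ccontr)
  assume "p \<noteq> q"
  then have "finite {x. poly (p - q) x = 0}"
    by (intro poly_roots_finite) simp
  moreover have "complex_of_real ` {-1..1} \<subseteq> {x. poly (p - q) x = 0}"
  proof safe
    fix x :: real
    assume "x \<in> {-1..1}"
    then have "x = cos (arccos x)" by simp
    then show "poly (p - q) (of_real x) = 0"
      using p[of "arccos x"] q[of "arccos x"] by simp
  qed
  ultimately have "finite (complex_of_real ` {-1..1})"
    by (rule rev_finite_subset)
  then have "finite {-1..1::real}"
    by (rule finite_imageD) (simp add: inj_on_def)
  then show False
    using infinite_Icc[of "-1::real" 1] by simp
qed

lemma cheb_exists:
  "\<exists>p::complex poly. \<forall>\<phi>::real. poly p (of_real (cos \<phi>)) = of_real (cos (real j * \<phi>))"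
proof (induction j rule: less_induct)
  case (less j)
  consider "j = 0" | "j = 1" | i where "j = Suc (Suc i)"
    by (metis One_nat_def old.nat.exhaust)
  then show ?case
  proof cases
    case 1
    then show ?thesis by (intro exI[of _ 1]) simp
  next
    case 2
    then show ?thesis by (intro exI[of _ "[:0, 1:]"]) simp
  next
    case (3 i)
    obtain p q :: "complex poly"
      where p: "\<forall>\<phi>::real. poly p (of_real (cos \<phi>)) = of_real (cos (real i * \<phi>))"
        and q: "\<forall>\<phi>::real. poly q (of_real (cos \<phi>)) = of_real (cos (real (Suc i) * \<phi>))"
      using less[of i] less[of "Suc i"] 3 by auto
    have "cos (real j * \<phi>) = 2 * cos \<phi> * cos (real (Suc i) * \<phi>) - cos (real i * \<phi>)" for \<phi>
    proof -
      define a where "a = real (Suc i) * \<phi>"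
      have "real j * \<phi> = a + \<phi>" "real i * \<phi> = a - \<phi>"
        by (simp_all add: a_def 3 algebra_simps)
      then show ?thesis
        by (simp del: of_nat_Suc add: a_def[symmetric] cos_add cos_diff)
    qed
    then show ?thesis
      using p q by (intro exI[of _ "[:0, 2:] * q - p"]) (simp del: of_nat_Suc)
  qed
qed

lemma poly_cheb_cos:
  fixes \<phi> :: real
  shows "poly (cheb j) (of_real (cos \<phi>)) = of_real (cos (real j * \<phi>))"
proof -
  obtain p :: "complex poly"
    where p: "\<forall>\<phi>::real. poly p (of_real (cos \<phi>)) = of_real (cos (real j * \<phi>))"
    using cheb_exists by blast
  have "cheb j = p"
    unfolding cheb_def
  proof (rule the_equality)
    fix q :: "complex poly"
    assume "\<forall>\<phi>::real. poly q (of_real (cos \<phi>)) = of_real (cos (real j * \<phi>))"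
    with p show "q = p"
      by (intro cheb_unique[where c = "\<lambda>\<phi>. of_real (cos (real j * \<phi>))"]) auto
  qed (rule p)
  with p show ?thesis
    by simp
qed


section \<open>The algebraic equation\<close>

text \<open>The division by \<open>[:-1, 1:]\<close>, i.e. by the polynomial \<open>w - 1\<close>, is exact.\<close>

definition Q_poly :: "nat \<Rightarrow> nat \<Rightarrow> complex poly" where
  "Q_poly k l = ((3 - 2 * cheb k) * (3 - 2 * cheb l) - 1) div [:-1, 1:]"

lemma Q_poly_exact:
  "Q_poly k l * [:-1, 1:] = (3 - 2 * cheb k) * (3 - 2 * cheb l) - 1"
proof -
  have "poly (cheb j) 1 = 1" for j
    using poly_cheb_cos[of j 0] by simp
  then have "[:-1, 1:] dvd (3 - 2 * cheb k) * (3 - 2 * cheb l) - 1"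
    by (subst poly_eq_0_iff_dvd[symmetric]) simp
  then show ?thesis
    unfolding Q_poly_def by (rule dvd_div_mult_self)
qed

end

theory Submission
  imports Defs "Jordan_Normal_Form.Char_Poly"
begin

text \<open>
  By Kirchhoff's matrix-tree theorem, the number of spanning trees is determined by the eigenvalues
  of the Laplacian. The Laplacian of an I-graph consists of circulant blocks, so the discrete Fourier
  transform splits it into \<open>n\<close> blocks of size two. The block with index \<open>m\<close> has determinant
  \<open>P (cos (2 * pi * m / n))\<close>, where \<open>P = (3 - 2 * cheb k) * (3 - 2 * cheb l) - 1\<close> is the product of
  \<open>Q_poly k l\<close> and \<open>w - 1\<close>. It follows that \<open>n\<close> times the number of spanning trees is the
  product of these values over \<open>0 < m < n\<close> (\<open>num_spanning_trees_I_graph\<close>).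

  The points \<open>cos (2 * pi * m / n)\<close> with \<open>0 \<le> m < n\<close> are the roots of \<open>cheb n - 1\<close>, with multiplicity
  (\<open>cheb_minus_1_factor\<close>). This product is therefore, up to a constant factor, the resultant of \<open>P\<close> and
  \<open>(cheb n - 1) / (w - 1)\<close>, and it can also be evaluated as a product over the roots of \<open>P\<close>. The root
  1 of \<open>P\<close> contributes \<open>n\<^sup>2\<close>, the derivative of \<open>cheb n\<close> at 1, up to sign and a power of two; the roots
  of \<open>Q_poly k l\<close> contribute the product in the theorem (\<open>prod_Q_poly_nodes\<close>).

  The matrix-tree theorem (\<open>matrix_tree\<close>) is proved by expanding the determinant along the edges in
  each row. The summands are indexed by functions that choose an edge at each vertex except the
  root; those functions in which the chosen edges lead to the root contribute 1, all others 0
  (\<open>det_functional_digraph\<close>), and the former correspond to the spanning trees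
  (\<open>bij_betw_arborescences_spanning_trees\<close>).
\<close>

section \<open>Spanning trees and parent edges\<close>

text \<open>
  For a loop the other end is the vertex itself, so that loops cancel in the Laplacian below and
  can never be parent edges.
\<close>

definition other_end :: "('v, 'e) multigraph \<Rightarrow> 'e \<Rightarrow> 'v \<Rightarrow> 'v" where
  "other_end G e v = (THE w. ends G e = {v, w})"

definition incident :: "('v, 'e) multigraph \<Rightarrow> 'v \<Rightarrow> 'e set" where
  "incident G v = {e \<in> edges G. v \<in> ends G e}"

text \<open>
  A spanning tree with root \<open>r\<close> assigns to every other vertex the first edge of its path to
  \<open>r\<close>, its parent edge. That the parents lead to \<open>r\<close> is expressed by a rank \<open>d\<close> that drops along
  each parent edge: a rank makes the inductions, the acyclicity argument and the determinant
  computation below immediate, where iterated parents would need path manipulations.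
\<close>

definition arborescences :: "('v, 'e) multigraph \<Rightarrow> 'v \<Rightarrow> ('v \<Rightarrow> 'e) set" where
  "arborescences G r = {f \<in> (\<Pi>\<^sub>E v \<in> verts G - {r}. incident G v).
     \<exists>d :: 'v \<Rightarrow> nat. \<forall>v \<in> verts G - {r}. d (other_end G (f v) v) < d v}"

lemma other_end_eq: "ends G e = {v, w} \<Longrightarrow> other_end G e v = w"
  unfolding other_end_def by (rule the_equality) (auto simp: doubleton_eq_iff)

locale finite_multigraph =
  fixes G :: "('v, 'e) multigraph"
  assumes finite_verts: "finite (verts G)"
    and finite_edges: "finite (edges G)"
    and ends_verts: "e \<in> edges G \<Longrightarrow> \<exists>x \<in> verts G. \<exists>y \<in> verts G. ends G e = {x, y}"
begin

lemma incident_ends: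
  assumes "e \<in> incident G v"
  shows "ends G e = {v, other_end G e v}" "other_end G e v \<in> verts G" "v \<in> verts G"
proof -
  have e: "e \<in> edges G" and v: "v \<in> ends G e"
    using assms by (auto simp: incident_def)
  obtain w where w: "ends G e = {v, w}"
    using ends_verts[OF e] v by (metis insert_commute insertE singletonD)
  then show "ends G e = {v, other_end G e v}"
    by (simp add: other_end_eq)
  moreover have "ends G e \<subseteq> verts G"
    using ends_verts[OF e] by auto
  ultimately show "other_end G e v \<in> verts G" "v \<in> verts G"
    by blast+
qed

lemma arborescence_incident:
  "f \<in> arborescences G r \<Longrightarrow> v \<in> verts G - {r} \<Longrightarrow> f v \<in> incident G v"
  unfolding arborescences_def by (blast dest: PiE_mem)

text \<open>
  Two vertices with the same parent edge would be parents of each other, and both ranks would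
  have to drop.
\<close>

lemma arborescence_inj:
  assumes f: "f \<in> arborescences G r"
  shows "inj_on f (verts G - {r})"
proof (rule inj_onI)
  fix v w
  assume v: "v \<in> verts G - {r}" and w: "w \<in> verts G - {r}" and eq: "f v = f w"
  obtain d :: "'v \<Rightarrow> nat" where d: "\<forall>v \<in> verts G - {r}. d (other_end G (f v) v) < d v"
    using f by (auto simp: arborescences_def)
  have "{v, other_end G (f v) v} = {w, other_end G (f w) w}"
    using incident_ends(1)[OF arborescence_incident[OF f v]]
      incident_ends(1)[OF arborescence_incident[OF f w]] eq by simp
  moreover have "d (other_end G (f v) v) < d v" "d (other_end G (f w) w) < d w"
    using d v w by auto
  ultimately show "v = w"
    by (auto simp: doubleton_eq_iff)
qed

lemma arborescence_connected:
  assumes f: "f \<in> arborescences G r" and r: "r \<in> verts G"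
  shows "connected_graph (G\<lparr>edges := f ` (verts G - {r})\<rparr>)"
proof -
  let ?H = "G\<lparr>edges := f ` (verts G - {r})\<rparr>"
  obtain d :: "'v \<Rightarrow> nat" where d: "\<forall>v \<in> verts G - {r}. d (other_end G (f v) v) < d v"
    using f by (auto simp: arborescences_def)
  have to_root: "(v, r) \<in> (adjacent ?H)\<^sup>*" if "v \<in> verts G" for v
    using that
  proof (induction "d v" arbitrary: v rule: less_induct)
    case less
    show ?case
    proof (cases "v = r")
      case False
      then have v: "v \<in> verts G - {r}"
        using less.prems by simp
      note inc = arborescence_incident[OF f v]
      have "(v, other_end G (f v) v) \<in> adjacent ?H"
        using incident_ends(1)[OF inc] v by (auto simp: adjacent_def)
      moreover have "(other_end G (f v) v, r) \<in> (adjacent ?H)\<^sup>*"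
        using less.hyps d v incident_ends(2)[OF inc] by blast
      ultimately show ?thesis
        by (rule converse_rtrancl_into_rtrancl)
    qed simp
  qed
  have "sym (adjacent ?H)"
    by (auto simp: sym_def adjacent_def insert_commute)
  then have "sym ((adjacent ?H)\<^sup>*)"
    by (rule sym_rtrancl)
  then have "(x, y) \<in> (adjacent ?H)\<^sup>*" if "x \<in> verts G" "y \<in> verts G" for x y
    using to_root[OF that(1)] to_root[OF that(2)] by (meson rtrancl_trans symD)
  then show ?thesis
    using r by (auto simp: connected_graph_def)
qed

text \<open>
  On a cycle, consider a vertex of greatest rank. Both cycle edges at it lead to vertices of rank
  no greater, so both are its parent edge.
\<close>

lemma arborescence_acyclic:
  assumes f: "f \<in> arborescences G r"
  shows "\<not> is_cycle (G\<lparr>edges := f ` (verts G - {r})\<rparr>) xs es"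
proof
  assume cyc: "is_cycle (G\<lparr>edges := f ` (verts G - {r})\<rparr>) xs es"
  obtain d :: "'v \<Rightarrow> nat" where d: "\<forall>v \<in> verts G - {r}. d (other_end G (f v) v) < d v"
    using f by (auto simp: arborescences_def)
  define m where "m = length xs"
  have m: "m > 0" "length es = m" and dist: "distinct es"
    and es: "set es \<subseteq> f ` (verts G - {r})"
    and ends: "\<And>i. i < m \<Longrightarrow> ends G (es ! i) = {xs ! i, xs ! (Suc i mod m)}"
    using cyc by (auto simp: is_cycle_def m_def)
  \<comment> \<open>Both cycle edges at a vertex of greatest rank would have to be its parent edge.\<close>
  have top: "e = f x" if e: "e \<in> set es" and xy: "ends G e = {x, y}" and le: "d y \<le> d x" for e x y
  proof -
    obtain v where v: "v \<in> verts G - {r}" "e = f v"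
      using e es by auto
    have "ends G e = {v, other_end G e v}" "d (other_end G e v) < d v"
      using incident_ends(1)[OF arborescence_incident[OF f v(1)]] d v by auto
    then have "v = x"
      using xy le by (auto simp: doubleton_eq_iff)
    with v show ?thesis by simp
  qed
  define D where "D = Max (d ` set xs)"
  have fin: "finite (d ` set xs)" "d ` set xs \<noteq> {}"
    using m by (auto simp: m_def)
  obtain i where i: "i < m" "d (xs ! i) = D"
    using Max_in[OF fin] by (auto simp: D_def m_def in_set_conv_nth)
  have le: "d (xs ! j) \<le> d (xs ! i)" if "j < m" for j
    using i Max_ge[OF fin(1)] that by (auto simp: D_def m_def)
  define j where "j = (if i = 0 then m - 1 else i - 1)"
  have j: "j < m" "Suc j mod m = i"
    using i m by (auto simp: j_def)
  have ei: "es ! i = f (xs ! i)"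
    by (rule top[OF _ ends[OF i(1)] le]) (use i m in auto)
  have ends_j: "ends G (es ! j) = {xs ! i, xs ! j}"
    using ends[OF j(1)] j(2) by (simp add: insert_commute)
  have ej: "es ! j = f (xs ! i)"
    by (rule top[OF _ ends_j le]) (use j m in auto)
  have "i = j"
    using ei ej i j m dist nth_eq_iff_index_eq by metis
  \<comment> \<open>Then the cycle is a loop, but a parent edge leads to a smaller rank.\<close>
  then have "ends G (es ! i) = {xs ! i}"
    using ends[OF i(1)] j by simp
  moreover obtain v where v: "v \<in> verts G - {r}" "es ! i = f v"
    using es i m by (metis imageE nth_mem subsetD)
  moreover have "ends G (f v) = {v, other_end G (f v) v}" "d (other_end G (f v) v) < d v"
    using incident_ends(1)[OF arborescence_incident[OF f v(1)]] d v by auto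
  ultimately show False
    by (auto simp: doubleton_eq_iff)
qed

text \<open>
  A spanning tree determines its parent edges. If \<open>f\<close> and \<open>g\<close> differed at \<open>v\<close>, they would also
  differ at the other end of \<open>g v\<close>, which has smaller \<open>g\<close>-rank: infinite descent.
\<close>

lemma arborescence_eq_if_image_eq:
  assumes f: "f \<in> arborescences G r" and g: "g \<in> arborescences G r"
    and img: "f ` (verts G - {r}) = g ` (verts G - {r})"
  shows "f = g"
proof (rule ccontr)
  assume "f \<noteq> g"
  obtain d :: "'v \<Rightarrow> nat" where d: "\<forall>v \<in> verts G - {r}. d (other_end G (g v) v) < d v"
    using g by (auto simp: arborescences_def)
  have agree: "f v = g v" if "v \<in> verts G - {r}" for v
    using that
  proof (induction "d v" arbitrary: v rule: less_induct)
    case less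
    show ?case
    proof (rule ccontr)
      assume ne: "f v \<noteq> g v"
      obtain w where w: "w \<in> verts G - {r}" "g v = f w"
        using img less.prems by (metis imageE imageI)
      have "v \<noteq> w"
        using ne w by auto
      \<comment> \<open>The edge \<open>g v\<close> is the \<open>f\<close>-parent edge of the other endpoint \<open>w\<close>, whose rank is smaller.\<close>
      moreover have "{v, other_end G (g v) v} = {w, other_end G (f w) w}"
        using incident_ends(1)[OF arborescence_incident[OF g less.prems]]
          incident_ends(1)[OF arborescence_incident[OF f w(1)]] w by simp
      ultimately have "w = other_end G (g v) v"
        by (auto simp: doubleton_eq_iff)
      then have "d w < d v"
        using d less.prems by auto
      then have "g w = g v"
        using less.hyps w by auto
      with \<open>v \<noteq> w\<close> show False
        using inj_onD[OF arborescence_inj[OF g] \<open>g w = g v\<close>] less.prems w by auto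
    qed
  qed
  have "f \<in> extensional (verts G - {r})" "g \<in> extensional (verts G - {r})"
    using f g by (auto simp: arborescences_def PiE_def)
  then have "f = g"
    using agree by (rule extensionalityI)
  with \<open>f \<noteq> g\<close> show False ..
qed

text \<open>
  The distance to the root is a rank: every other vertex has an edge to a closer vertex.
\<close>

lemma connected_has_arborescence:
  assumes F: "F \<subseteq> edges G" and conn: "connected_graph (G\<lparr>edges := F\<rparr>)" and r: "r \<in> verts G"
  shows "\<exists>f \<in> arborescences G r. f ` (verts G - {r}) \<subseteq> F"
proof -
  let ?A = "adjacent (G\<lparr>edges := F\<rparr>)"
  define d where "d v = (LEAST k. (v, r) \<in> ?A ^^ k)" for v
  have step: "\<exists>e. e \<in> F \<and> (\<exists>w. ends G e = {v, w} \<and> d w < d v)" if v: "v \<in> verts G - {r}" for v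
  proof -
    have "(v, r) \<in> ?A\<^sup>*"
      using conn v r by (auto simp: connected_graph_def)
    then have dv: "(v, r) \<in> ?A ^^ d v"
      unfolding d_def using rtrancl_power LeastI_ex by metis
    obtain k where k: "d v = Suc k"
      using dv v by (cases "d v") auto
    obtain w where w: "(v, w) \<in> ?A" "(w, r) \<in> ?A ^^ k"
      using dv k relpow_Suc_D2 by metis
    have "d w \<le> k"
      unfolding d_def by (rule Least_le) (rule w)
    then have "d w < d v"
      using k by simp
    moreover obtain e where "e \<in> F" "ends G e = {v, w}"
      using w(1) by (auto simp: adjacent_def)
    ultimately show ?thesis
      by blast
  qed
  define f where "f = (\<lambda>v \<in> verts G - {r}. SOME e. e \<in> F \<and> (\<exists>w. ends G e = {v, w} \<and> d w < d v))"
  have fF: "f v \<in> F" and fd: "\<exists>w. ends G (f v) = {v, w} \<and> d w < d v"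
    if "v \<in> verts G - {r}" for v
    using someI_ex[OF step[OF that]] that by (simp_all add: f_def)
  have "f v \<in> incident G v" if "v \<in> verts G - {r}" for v
    using fF[OF that] fd[OF that] F by (auto simp: incident_def)
  then have "f \<in> (\<Pi>\<^sub>E v \<in> verts G - {r}. incident G v)"
    by (rule PiE_I) (auto simp: f_def)
  moreover have "d (other_end G (f v) v) < d v" if "v \<in> verts G - {r}" for v
    using fd[OF that] by (auto simp: other_end_eq)
  ultimately have "f \<in> arborescences G r"
    unfolding arborescences_def by blast
  then show ?thesis
    using fF by blast
qed

text \<open>
  An edge that is no parent edge closes a cycle with the two parent paths that start at its
  ends, followed up to the first vertex at which they meet. Together with the previous lemma this
  shows that every spanning tree consists of the parent edges of an arborescence.
\<close>

lemma extra_edge_gives_cycle: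
  assumes f: "f \<in> arborescences G r" and r: "r \<in> verts G"
    and F: "F \<subseteq> edges G" "f ` (verts G - {r}) \<subseteq> F"
    and e: "e \<in> F" "e \<notin> f ` (verts G - {r})"
  shows "\<exists>xs es. is_cycle (G\<lparr>edges := F\<rparr>) xs es"
proof -
  obtain d :: "'v \<Rightarrow> nat" where d: "\<forall>v \<in> verts G - {r}. d (other_end G (f v) v) < d v"
    using f by (auto simp: arborescences_def)
  \<comment> \<open>Making the root its own parent keeps iterated parents inside the graph.\<close>
  define p where "p v = (if v = r then r else other_end G (f v) v)" for v
  have p_ends: "ends G (f v) = {v, p v}" and p_verts: "p v \<in> verts G" and p_d: "d (p v) < d v"
    if "v \<in> verts G - {r}" for v
    using incident_ends[OF arborescence_incident[OF f that]] d that by (auto simp: p_def)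
  have verts: "(p ^^ i) v \<in> verts G" if "v \<in> verts G" for i v
    using that p_verts by (induction i) (auto simp: p_def)
  have root: "\<exists>i. (p ^^ i) v = r" if "v \<in> verts G" for v
    using that
  proof (induction "d v" arbitrary: v rule: less_induct)
    case less
    show ?case
    proof (cases "v = r")
      case True
      then show ?thesis by (intro exI[of _ 0]) simp
    next
      case False
      then obtain i where "(p ^^ i) (p v) = r"
        using less p_d[of v] p_verts[of v] by auto
      then show ?thesis
        by (intro exI[of _ "Suc i"]) (simp add: funpow_Suc_right del: funpow.simps)
    qed
  qed
  have root_fix: "(p ^^ (i + j)) v = r" if "(p ^^ i) v = r" for i j v
    using that by (induction j) (auto simp: p_def)
  have inj: "inj_on (\<lambda>i. (p ^^ i) v) {..a}" if v: "v \<in> verts G" and a: "\<And>i. i < a \<Longrightarrow> (p ^^ i) v \<noteq> r" for v a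
  proof -
    have "d ((p ^^ j) v) < d ((p ^^ i) v)" if "i < j" "j \<le> a" for i j
      using that
    proof (induction j)
      case (Suc j)
      have "d ((p ^^ Suc j) v) < d ((p ^^ j) v)"
        using p_d[of "(p ^^ j) v"] verts[OF v] a[of j] Suc.prems by auto
      then show ?case
        using Suc by (cases "i = j") auto
    qed simp
    then have "(p ^^ i) v \<noteq> (p ^^ j) v" if "i < j" "j \<le> a" for i j
      using that by (metis less_irrefl)
    then show ?thesis
      by (intro linorder_inj_onI) auto
  qed
  obtain x y where xy: "ends G e = {x, y}" "x \<in> verts G" "y \<in> verts G"
    using ends_verts e F by blast
  define P where "P i = (p ^^ i) x" for i
  define Q where "Q i = (p ^^ i) y" for i
  obtain a b where ab: "P a = r" "Q b = r"
    using root[OF xy(2)] root[OF xy(3)] by (auto simp: P_def Q_def)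
  \<comment> \<open>\<open>P m = Q n\<close> is the first vertex at which the two paths to the root meet.\<close>
  define m where "m = (LEAST i. \<exists>j. P i = Q j)"
  have "\<exists>i j. P i = Q j"
    using ab by metis
  then have "\<exists>j. P m = Q j"
    unfolding m_def by (rule LeastI_ex)
  define n where "n = (LEAST j. P m = Q j)"
  have meet: "P m = Q n"
    unfolding n_def by (rule LeastI_ex) fact
  have Pm: "P i \<noteq> Q j" if "i < m" for i j
    using not_less_Least[of i "\<lambda>i. \<exists>j. P i = Q j"] that by (auto simp: m_def)
  have Qn: "P m \<noteq> Q j" if "j < n" for j
    using not_less_Least[of j "\<lambda>j. P m = Q j"] that by (auto simp: n_def)
  have Pr: "P i \<noteq> r" if "i < m" for i
    using Pm[OF that, of b] ab by simp
  have Qr: "Q j \<noteq> r" if "j < n" for j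
    using Qn[OF that] root_fix[of j y "n - j"] meet that by (auto simp: Q_def)
  have PV: "P i \<in> verts G" "Q i \<in> verts G" for i
    using verts xy by (auto simp: P_def Q_def)
  have injP: "inj_on P {..m}" and injQ: "inj_on Q {..n}"
    using inj[of x m] inj[of y n] xy Pr Qr by (auto simp: P_def[abs_def] Q_def[abs_def])
  \<comment> \<open>The cycle runs from \<open>x\<close> up along \<open>P\<close> to the meeting vertex and down along \<open>Q\<close> to \<open>y\<close>. Its
      \<open>t\<close>-th edge is the parent edge of its lower end \<open>Y t\<close>, and \<open>e\<close> is the last edge.\<close>
  define X where "X t = (if t \<le> m then P t else Q (m + n - t))" for t
  define Y where "Y t = (if t < m then P t else Q (m + n - 1 - t))" for t
  define E where "E t = (if t < m + n then f (Y t) else e)" for t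
  define N where "N = m + n + 1"
  have injX: "inj_on X {..<N}"
  proof (rule linorder_inj_onI)
    fix s t
    assume st: "s < t" and t: "t \<in> {..<N}"
    consider "t \<le> m" | "s < m" "m < t" | "s = m" "m < t" | "m < s"
      using st by linarith
    then show "X s \<noteq> X t"
    proof cases
      case 1
      then show ?thesis
        using inj_onD[OF injP, of s t] st by (auto simp: X_def)
    next
      case 2
      then show ?thesis
        using Pm[of s "m + n - t"] by (simp add: X_def)
    next
      case 3
      then show ?thesis
        using Qn[of "m + n - t"] t by (simp add: X_def N_def)
    next
      case 4
      then have "m + n - s \<noteq> m + n - t" "m + n - s \<le> n" "m + n - t \<le> n"
        using st t by (auto simp: N_def)
      then show ?thesis
        using inj_onD[OF injQ, of "m + n - s" "m + n - t"] 4 st by (auto simp: X_def)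
    qed
  qed auto
  have injY: "inj_on Y {..<m + n}"
  proof (rule linorder_inj_onI)
    fix s t
    assume st: "s < t" and t: "t \<in> {..<m + n}"
    consider "t < m" | "s < m" "m \<le> t" | "m \<le> s"
      using st by linarith
    then show "Y s \<noteq> Y t"
    proof cases
      case 1
      then show ?thesis
        using inj_onD[OF injP, of s t] st by (auto simp: Y_def)
    next
      case 2
      then show ?thesis
        using Pm[of s "m + n - 1 - t"] by (simp add: Y_def)
    next
      case 3
      then have "m + n - 1 - s \<noteq> m + n - 1 - t" "m + n - 1 - s \<le> n" "m + n - 1 - t \<le> n"
        using st t by auto
      then show ?thesis
        using inj_onD[OF injQ, of "m + n - 1 - s" "m + n - 1 - t"] 3 st by (auto simp: Y_def)
    qed
  qed auto
  have Yr: "Y t \<in> verts G - {r}" if "t < m + n" for t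
    using that Pr Qr PV by (auto simp: Y_def)
  have injE: "inj_on E {..<N}"
  proof (rule linorder_inj_onI)
    fix s t
    assume "s < t" and t: "t \<in> {..<N}"
    then have s: "s < m + n"
      by (simp add: N_def)
    show "E s \<noteq> E t"
    proof (cases "t < m + n")
      case True
      then have "Y s \<noteq> Y t"
        using inj_onD[OF injY, of s t] \<open>s < t\<close> by auto
      then have "f (Y s) \<noteq> f (Y t)"
        using inj_onD[OF arborescence_inj[OF f] _ Yr[OF s] Yr[OF True]] by blast
      then show ?thesis
        using s True by (simp add: E_def)
    next
      case False
      have "f (Y s) \<in> f ` (verts G - {r})"
        using Yr[OF s] by (rule imageI)
      then show ?thesis
        using e s False by (auto simp: E_def)
    qed
  qed auto
  have pY: "p (Y t) = (if t < m then P (Suc t) else Q (m + n - t))" if "t < m + n" for t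
  proof (cases "t < m")
    case True
    then show ?thesis
      by (simp add: Y_def P_def)
  next
    case False
    then have "Suc (m + n - 1 - t) = m + n - t"
      using that by linarith
    moreover have "p (Y t) = Q (Suc (m + n - 1 - t))"
      using False by (simp add: Y_def Q_def)
    ultimately show ?thesis
      using False by simp
  qed
  have ends: "ends G (E t) = {X t, X (Suc t mod N)}" if "t < N" for t
  proof (cases "t < m + n")
    case True
    have "{Y t, p (Y t)} = {X t, X (Suc t)}"
    proof (cases "t < m")
      case True
      then show ?thesis
        unfolding pY[OF \<open>t < m + n\<close>] by (simp add: X_def Y_def)
    next
      case False
      then have "X t = Q (m + n - t)"
        using meet by (cases "t = m") (simp_all add: X_def)
      moreover have "X (Suc t) = Y t"
        using False by (simp add: X_def Y_def)
      ultimately show ?thesis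
        unfolding pY[OF \<open>t < m + n\<close>] using False by (simp add: insert_commute)
    qed
    then show ?thesis
      using p_ends[OF Yr[OF True]] True by (simp add: E_def N_def)
  next
    case False
    then have t: "t = m + n"
      using that by (simp add: N_def)
    have "X t = y"
      using meet by (cases "n = 0") (simp_all add: t X_def Q_def)
    moreover have "X 0 = x"
      by (simp add: X_def P_def)
    ultimately show ?thesis
      using xy(1) by (simp add: t E_def N_def insert_commute)
  qed
  have "E t \<in> F" if "t < N" for t
    using F(2) e(1) Yr[of t] by (auto simp: E_def)
  moreover have "X t \<in> verts G" for t
    using PV by (simp add: X_def)
  ultimately have "is_cycle (G\<lparr>edges := F\<rparr>) (map X [0..<N]) (map E [0..<N])"
    using injX injE ends unfolding is_cycle_def
    by (auto simp: distinct_map atLeast0LessThan N_def simp del: upt_Suc)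
  then show ?thesis by blast
qed

lemma bij_betw_arborescences_spanning_trees:
  assumes r: "r \<in> verts G"
  shows "bij_betw (\<lambda>f. f ` (verts G - {r})) (arborescences G r) (spanning_trees G)"
  unfolding bij_betw_def
proof (intro conjI equalityI subsetI)
  show "inj_on (\<lambda>f. f ` (verts G - {r})) (arborescences G r)"
    by (intro inj_onI arborescence_eq_if_image_eq)
next
  fix F
  assume "F \<in> (\<lambda>f. f ` (verts G - {r})) ` arborescences G r"
  then obtain f where f: "f \<in> arborescences G r" "F = f ` (verts G - {r})"
    by auto
  then have "F \<subseteq> edges G"
    using arborescence_incident[OF f(1)] by (auto simp: incident_def)
  then show "F \<in> spanning_trees G"
    using arborescence_connected[OF f(1) r] arborescence_acyclic[OF f(1)] f(2)
    by (auto simp: spanning_trees_def is_tree_def)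
next
  fix F
  assume "F \<in> spanning_trees G"
  then have F: "F \<subseteq> edges G" "connected_graph (G\<lparr>edges := F\<rparr>)"
    "\<not> (\<exists>xs es. is_cycle (G\<lparr>edges := F\<rparr>) xs es)"
    by (auto simp: spanning_trees_def is_tree_def)
  obtain f where f: "f \<in> arborescences G r" "f ` (verts G - {r}) \<subseteq> F"
    using connected_has_arborescence[OF F(1,2) r] by auto
  moreover have "F \<subseteq> f ` (verts G - {r})"
    using extra_edge_gives_cycle[OF f(1) r F(1) f(2)] F(3) by blast
  ultimately show "F \<in> (\<lambda>f. f ` (verts G - {r})) ` arborescences G r"
    by auto
qed

end

section \<open>The matrix-tree theorem\<close>

lemma det_mat_leibniz:
  fixes c :: "nat \<Rightarrow> nat \<Rightarrow> 'a :: comm_ring_1"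
  shows "det (mat m m (\<lambda>(i, j). c i j)) =
    (\<Sum>q | q permutes {0..<m}. signof q * (\<Prod>i = 0..<m. c i (q i)))"
proof -
  have "(\<Prod>i = 0..<m. mat m m (\<lambda>(i, j). c i j) $$ (i, q i)) = (\<Prod>i = 0..<m. c i (q i))"
    if "q permutes {0..<m}" for q
    using permutes_in_image[OF that] by (intro prod.cong) auto
  then show ?thesis
    by (subst det_def'[of _ m]) (auto intro!: sum.cong)
qed

text \<open>
  Here \<open>p\<close> sends every non-root vertex to its parent, and the matrix is the identity minus the
  adjacency matrix of \<open>p\<close> on the non-root vertices. If there is a rank, a permutation that contributes to
  the determinant moves each vertex to itself or to its parent; since it preserves the sum of all ranks, it is the
  identity, which contributes 1. If there is no rank, some vertices never reach the root, and their
  indicator vector is in the kernel.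
\<close>

lemma det_functional_digraph:
  fixes h :: "nat \<Rightarrow> 'v" and p :: "'v \<Rightarrow> 'v"
  assumes h: "bij_betw h {0..<m} W" and r: "r \<notin> W" and p: "\<And>v. v \<in> W \<Longrightarrow> p v \<in> insert r W"
  shows "det (mat m m (\<lambda>(i, j). of_bool (i = j) - of_bool (p (h i) = h j)) :: 'a :: field mat) =
    of_bool (\<exists>d :: 'v \<Rightarrow> nat. \<forall>v \<in> W. d (p v) < d v)"
proof (cases "\<exists>d :: 'v \<Rightarrow> nat. \<forall>v \<in> W. d (p v) < d v")
  case True
  then obtain d :: "'v \<Rightarrow> nat" where d: "\<And>v. v \<in> W \<Longrightarrow> d (p v) < d v"
    by auto
  define a :: "nat \<Rightarrow> nat \<Rightarrow> 'a" where "a i j = of_bool (i = j) - of_bool (p (h i) = h j)" for i j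
  have hW: "h i \<in> W" if "i < m" for i
    using h that by (auto simp: bij_betw_def)
  \<comment> \<open>A permutation that moves a vertex to its parent would lower the sum of the ranks.\<close>
  have other: "(\<Prod>i = 0..<m. a i (q i)) = 0" if q: "q permutes {0..<m}" and "q \<noteq> id" for q
  proof (rule ccontr)
    assume "(\<Prod>i = 0..<m. a i (q i)) \<noteq> 0"
    then have nz: "q i = i \<or> p (h i) = h (q i)" if "i < m" for i
    proof -
      have "a i (q i) \<noteq> 0"
        using \<open>(\<Prod>i = 0..<m. a i (q i)) \<noteq> 0\<close> that by (auto simp: prod_zero_iff)
      then show ?thesis
        by (auto simp: a_def of_bool_def split: if_splits)
    qed
    have le: "d (h (q i)) \<le> d (h i)" if "i < m" for i
      using nz[OF that] d[OF hW[OF that]] by auto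
    obtain i where i: "q i \<noteq> i"
      using \<open>q \<noteq> id\<close> by (metis eq_id_iff)
    then have "i < m"
      using q by (metis atLeastLessThan_iff le0 permutes_not_in)
    then have "d (h (q i)) < d (h i)"
      using nz[of i] i d[OF hW[of i]] by auto
    then have "(\<Sum>i = 0..<m. d (h (q i))) < (\<Sum>i = 0..<m. d (h i))"
      using le \<open>i < m\<close> by (intro sum_strict_mono_ex1) auto
    moreover have "(\<Sum>i = 0..<m. d (h (q i))) = (\<Sum>i = 0..<m. d (h i))"
      using sum.permute[OF q, of "\<lambda>i. d (h i)"] by (simp add: o_def)
    ultimately show False by simp
  qed
  have "a i i = 1" if "i < m" for i
    using d[OF hW[OF that]] by (auto simp: a_def)
  then have diag: "(\<Prod>i = 0..<m. a i (id i)) = 1"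
    by (intro prod.neutral) auto
  have "det (mat m m (\<lambda>(i, j). a i j)) =
      (\<Sum>q | q permutes {0..<m}. signof q * (\<Prod>i = 0..<m. a i (q i)))"
    by (rule det_mat_leibniz)
  also have "\<dots> = (\<Sum>q \<in> {id}. signof q * (\<Prod>i = 0..<m. a i (q i)))"
    using other by (intro sum.mono_neutral_right) (auto simp: finite_permutations permutes_id)
  also have "\<dots> = 1"
    using diag by simp
  finally show ?thesis
    using True by (simp add: a_def)
next
  case False
  define reach where "reach v \<longleftrightarrow> (\<exists>k. (p ^^ k) v = r)" for v
  have reach_r: "reach r"
    unfolding reach_def by (intro exI[of _ 0]) simp
  have reach_p: "reach (p v) \<longleftrightarrow> reach v" if "v \<in> W" for v
  proof
    assume "reach (p v)"
    then obtain k where "(p ^^ k) (p v) = r"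
      by (auto simp: reach_def)
    then show "reach v"
      unfolding reach_def by (intro exI[of _ "Suc k"]) (simp add: funpow_Suc_right del: funpow.simps)
  next
    assume "reach v"
    then obtain k where k: "(p ^^ k) v = r"
      by (auto simp: reach_def)
    with that r obtain k' where "k = Suc k'"
      by (cases k) auto
    with k show "reach (p v)"
      unfolding reach_def by (auto simp add: funpow_Suc_right simp del: funpow.simps)
  qed
  \<comment> \<open>If every vertex reached the root, the number of steps would be a rank function.\<close>
  have "\<exists>v \<in> W. \<not> reach v"
  proof (rule ccontr)
    assume all: "\<not> (\<exists>v \<in> W. \<not> reach v)"
    define d where "d v = (LEAST k. (p ^^ k) v = r)" for v
    have "d (p v) < d v" if v: "v \<in> W" for v
    proof -
      have "\<exists>k. (p ^^ k) v = r"
        using all v by (auto simp: reach_def)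
      then have dv: "(p ^^ d v) v = r"
        unfolding d_def by (rule LeastI_ex)
      obtain k where k: "d v = Suc k"
        using dv v r by (cases "d v") auto
      have "(p ^^ k) (p v) = r"
        using dv k by (simp add: funpow_Suc_right del: funpow.simps)
      then have "d (p v) \<le> k"
        unfolding d_def by (rule Least_le)
      with k show ?thesis by simp
    qed
    with False show False by blast
  qed
  then obtain v0 where v0: "v0 \<in> W" "\<not> reach v0"
    by auto
  \<comment> \<open>The indicator of the vertices that never reach the root is in the kernel.\<close>
  let ?M = "mat m m (\<lambda>(i, j). of_bool (i = j) - of_bool (p (h i) = h j)) :: 'a mat"
  define x :: "'a vec" where "x = vec m (\<lambda>i. of_bool (\<not> reach (h i)))"
  have "x \<noteq> 0\<^sub>v m"
  proof -
    obtain i where "i < m" "h i = v0"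
      using h v0 by (auto simp: bij_betw_def)
    then have "x $ i \<noteq> 0\<^sub>v m $ i"
      using v0 by (simp add: x_def)
    then show ?thesis by auto
  qed
  moreover have "?M *\<^sub>v x = 0\<^sub>v m"
  proof (rule eq_vecI)
    fix i
    assume "i < dim_vec (0\<^sub>v m :: 'a vec)"
    then have i: "i < m" by simp
    then have hi: "h i \<in> W"
      using h by (auto simp: bij_betw_def)
    have "(?M *\<^sub>v x) $ i =
        (\<Sum>j = 0..<m. (of_bool (i = j) - of_bool (p (h i) = h j)) * of_bool (\<not> reach (h j)))"
      using i by (auto simp: x_def scalar_prod_def intro!: sum.cong)
    also have "\<dots> = (\<Sum>j = 0..<m. of_bool (i = j) * of_bool (\<not> reach (h j))) -
        (\<Sum>j = 0..<m. of_bool (p (h i) = h j) * of_bool (\<not> reach (h j)))"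
      by (simp add: algebra_simps sum_subtractf)
    also have "(\<Sum>j = 0..<m. of_bool (i = j) * of_bool (\<not> reach (h j))) = (of_bool (\<not> reach (h i)) :: 'a)"
      using i sum.delta[of "{0..<m}" i "\<lambda>j. of_bool (\<not> reach (h j)) :: 'a"]
      by (simp add: of_bool_def if_distrib[where f = "\<lambda>x. x * _"] cong: if_cong)
    also have "(\<Sum>j = 0..<m. of_bool (p (h i) = h j) * of_bool (\<not> reach (h j))) =
        (\<Sum>w \<in> W. of_bool (p (h i) = w) * of_bool (\<not> reach w) :: 'a)"
      by (rule sum.reindex_bij_betw[OF h])
    also have "\<dots> = of_bool (\<not> reach (p (h i)))"
    proof (cases "p (h i) = r")
      case True
      then have "(\<Sum>w \<in> W. of_bool (p (h i) = w) * of_bool (\<not> reach w) :: 'a) = 0"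
        using r by (intro sum.neutral) auto
      then show ?thesis
        using True reach_r by simp
    next
      case False
      then have "p (h i) \<in> W"
        using p[OF hi] by simp
      moreover have "finite W"
        using h bij_betw_finite by blast
      ultimately show ?thesis
        using sum.delta[of W "p (h i)" "\<lambda>w. of_bool (\<not> reach w) :: 'a"]
        by (simp add: of_bool_def if_distrib[where f = "\<lambda>x. x * _"] cong: if_cong)
    qed
    finally show "(?M *\<^sub>v x) $ i = 0\<^sub>v m $ i"
      using i reach_p[OF hi] by simp
  qed simp
  ultimately have "det ?M = 0"
    by (subst det_0_iff_vec_prod_zero_field[of _ m]) (auto simp: x_def intro!: exI[of _ x])
  then show ?thesis
    using False by simp
qed

text \<open>
  The usual definition (degree on the diagonal, minus the number of connecting edges elsewhere),
  written as one summand per edge so that the rows can be expanded edge by edge.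
\<close>

definition laplacian :: "('v, 'e) multigraph \<Rightarrow> 'v \<Rightarrow> 'v \<Rightarrow> 'a :: field" where
  "laplacian G u v = (\<Sum>e \<in> incident G u. of_bool (u = v) - of_bool (other_end G e u = v))"

text \<open>
  Kirchhoff's theorem. Every row of the reduced Laplacian is a sum over the edges at its vertex, so
  the determinant is a sum over all choices \<open>f\<close> of one edge at each non-root vertex. The summand of
  \<open>f\<close> is the determinant of the functional digraph of \<open>f\<close>, which is 1 if \<open>f\<close> is an arborescence
  and 0 otherwise.
\<close>

theorem (in finite_multigraph) matrix_tree:
  assumes r: "r \<in> verts G" and h: "bij_betw h {0..<m} (verts G - {r})"
  shows "det (mat m m (\<lambda>(i, j). laplacian G (h i) (h j)) :: 'a :: field mat) =
    of_nat (num_spanning_trees G)"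
proof -
  let ?W = "verts G - {r}"
  define t :: "'e \<Rightarrow> 'v \<Rightarrow> 'v \<Rightarrow> 'a" where
    "t e u v = of_bool (u = v) - of_bool (other_end G e u = v)" for e u v
  define D where "D f = mat m m (\<lambda>(i, j). t (f (h i)) (h i) (h j))" for f
  have finW: "finite ?W"
    using finite_verts by simp
  have fin_inc: "finite (incident G v)" for v
    using finite_edges by (simp add: incident_def)
  have hi: "h i \<in> ?W" if "i < m" for i
    using h that by (auto simp: bij_betw_def)
  define h' where "h' = inv_into {0..<m} h"
  have h': "h' (h i) = i" if "i < m" for i
    unfolding h'_def using h that by (intro inv_into_f_f) (auto simp: bij_betw_def)
  \<comment> \<open>Each row is a sum over the edges at its vertex; expand the product of the rows.\<close>
  have expand: "(\<Prod>i = 0..<m. laplacian G (h i) (h (q i))) =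
      (\<Sum>f \<in> Pi\<^sub>E ?W (incident G). \<Prod>i = 0..<m. t (f (h i)) (h i) (h (q i)))" for q
  proof -
    have "(\<Prod>i = 0..<m. laplacian G (h i) (h (q i))) =
        (\<Prod>i = 0..<m. (\<lambda>v. \<Sum>e \<in> incident G v. t e v (h (q (h' v)))) (h i))"
      by (intro prod.cong) (auto simp: laplacian_def t_def h')
    also have "\<dots> = (\<Prod>v \<in> ?W. \<Sum>e \<in> incident G v. t e v (h (q (h' v))))"
      by (rule prod.reindex_bij_betw[OF h])
    also have "\<dots> = (\<Sum>f \<in> Pi\<^sub>E ?W (incident G). \<Prod>v \<in> ?W. t (f v) v (h (q (h' v))))"
      using finW fin_inc by (rule prod_sum_PiE)
    also have "\<dots> = (\<Sum>f \<in> Pi\<^sub>E ?W (incident G). \<Prod>i = 0..<m. t (f (h i)) (h i) (h (q (h' (h i)))))"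
      by (intro sum.cong refl prod.reindex_bij_betw[OF h, symmetric])
    also have "\<dots> = (\<Sum>f \<in> Pi\<^sub>E ?W (incident G). \<Prod>i = 0..<m. t (f (h i)) (h i) (h (q i)))"
      by (intro sum.cong prod.cong refl) (simp add: h')
    finally show ?thesis .
  qed
  have "det (mat m m (\<lambda>(i, j). laplacian G (h i) (h j)) :: 'a mat) =
      (\<Sum>q | q permutes {0..<m}. \<Sum>f \<in> Pi\<^sub>E ?W (incident G).
        signof q * (\<Prod>i = 0..<m. t (f (h i)) (h i) (h (q i))))"
    unfolding det_mat_leibniz expand by (simp add: sum_distrib_left)
  also have "\<dots> = (\<Sum>f \<in> Pi\<^sub>E ?W (incident G). det (D f))"
    unfolding D_def det_mat_leibniz by (rule sum.swap)
  also have "\<dots> = (\<Sum>f \<in> Pi\<^sub>E ?W (incident G). of_bool (f \<in> arborescences G r))"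
  proof (rule sum.cong[OF refl])
    fix f
    assume f: "f \<in> Pi\<^sub>E ?W (incident G)"
    let ?p = "\<lambda>v. other_end G (f v) v"
    have "?p v \<in> insert r ?W" if "v \<in> ?W" for v
      using incident_ends(2)[of "f v" v] PiE_mem[OF f that] by auto
    then have "det (mat m m (\<lambda>(i, j). of_bool (i = j) - of_bool (?p (h i) = h j)) :: 'a mat) =
        of_bool (\<exists>d :: 'v \<Rightarrow> nat. \<forall>v \<in> ?W. d (?p v) < d v)"
      by (intro det_functional_digraph[OF h, of r]) auto
    also have "mat m m (\<lambda>(i, j). of_bool (i = j) - of_bool (?p (h i) = h j)) = D f"
      unfolding D_def t_def using h
      by (intro eq_matI) (auto simp: bij_betw_def dest: inj_onD)
    also have "(\<exists>d :: 'v \<Rightarrow> nat. \<forall>v \<in> ?W. d (?p v) < d v) \<longleftrightarrow> f \<in> arborescences G r"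
      using f unfolding arborescences_def by blast
    finally show "det (D f) = of_bool (f \<in> arborescences G r)" .
  qed
  also have "\<dots> = (\<Sum>f \<in> arborescences G r. 1)"
  proof (rule sum.mono_neutral_cong_right)
    show "finite (Pi\<^sub>E ?W (incident G))"
      using finW fin_inc by (rule finite_PiE)
    show "arborescences G r \<subseteq> Pi\<^sub>E ?W (incident G)"
      unfolding arborescences_def by blast
  qed auto
  also have "\<dots> = of_nat (num_spanning_trees G)"
    using bij_betw_same_card[OF bij_betw_arborescences_spanning_trees[OF r]]
    by (simp add: num_spanning_trees_def)
  finally show ?thesis .
qed

section \<open>Determinants of circulant matrices\<close>

definition unity_root :: "nat \<Rightarrow> nat \<Rightarrow> complex" where
  "unity_root n j = cis (2 * pi * real j / real n)"

lemma unity_root_0 [simp]: "unity_root n 0 = 1"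
  by (simp add: unity_root_def)

lemma unity_root_add: "unity_root n (i + j) = unity_root n i * unity_root n j"
  by (simp add: unity_root_def cis_mult ring_distribs add_divide_distrib)

lemma unity_root_mult: "unity_root n (i * j) = unity_root n i ^ j"
  by (induction j) (simp_all add: unity_root_add mult.commute)

lemma unity_root_period:
  assumes "n > 0"
  shows "unity_root n (n * q) = 1"
proof -
  have "unity_root n n = 1"
    using assms by (simp add: unity_root_def)
  then show ?thesis
    by (simp add: unity_root_mult)
qed

lemma unity_root_mod:
  assumes "n > 0"
  shows "unity_root n (i mod n) = unity_root n i"
proof -
  have "unity_root n i = unity_root n (n * (i div n) + i mod n)"
    by simp
  then show ?thesis
    using unity_root_period[OF assms] by (simp only: unity_root_add) simp
qed

lemma unity_root_mod_mult:
  assumes "n > 0"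
  shows "unity_root n ((i mod n) * j) = unity_root n (i * j)"
  by (simp only: unity_root_mult unity_root_mod[OF assms])

lemma unity_root_cnj: "unity_root n j * cnj (unity_root n j) = 1"
  by (simp add: unity_root_def cis_cnj cis_mult)

lemma unity_root_add_cnj:
  "unity_root n j + cnj (unity_root n j) = complex_of_real (2 * cos (2 * pi * real j / real n))"
  by (simp add: unity_root_def complex_eq_iff)

lemma unity_root_bij:
  "n > 0 \<Longrightarrow> bij_betw (unity_root n) {..<n} {z. z ^ n = 1}"
  using bij_betw_roots_unity[of n] by (simp add: unity_root_def[abs_def])

definition fourier_mat :: "nat \<Rightarrow> complex mat" where
  "fourier_mat n = mat n n (\<lambda>(i, m). unity_root n (i * m))"

lemma fourier_mat_carrier [simp]: "fourier_mat n \<in> carrier_mat n n"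
  by (simp add: fourier_mat_def)

text \<open>
  The characters of the cyclic group are orthogonal, so the product with the conjugate matrix is
  \<open>n\<close> times the identity.
\<close>

lemma det_fourier_mat_nonzero:
  assumes n: "n > 0"
  shows "det (fourier_mat n) \<noteq> 0"
proof -
  let ?W' = "mat n n (\<lambda>(m, j). cnj (unity_root n (m * j)))"
  have "fourier_mat n * ?W' = of_nat n \<cdot>\<^sub>m 1\<^sub>m n"
  proof (rule eq_matI)
    fix i j
    assume "i < dim_row (of_nat n \<cdot>\<^sub>m 1\<^sub>m n :: complex mat)"
      and "j < dim_col (of_nat n \<cdot>\<^sub>m 1\<^sub>m n :: complex mat)"
    then have ij: "i < n" "j < n" by auto
    define z where "z = unity_root n i * cnj (unity_root n j)"
    have "(fourier_mat n * ?W') $$ (i, j) =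
        (\<Sum>m = 0..<n. unity_root n (i * m) * cnj (unity_root n (j * m)))"
      using ij by (simp add: fourier_mat_def scalar_prod_def mult.commute)
    also have "\<dots> = (\<Sum>m < n. z ^ m)"
      by (simp add: unity_root_mult z_def power_mult_distrib atLeast0LessThan)
    also have "\<dots> = (if i = j then of_nat n else 0)"
    proof (cases "i = j")
      case True
      then have "z = 1"
        by (simp add: z_def unity_root_cnj)
      then show ?thesis
        using True by simp
    next
      case False
      have "z \<noteq> 1"
      proof
        assume "z = 1"
        have "unity_root n i = z * unity_root n j"
          using unity_root_cnj[of n j] by (simp add: z_def mult.commute mult.left_commute)
        then have "unity_root n i = unity_root n j"
          using \<open>z = 1\<close> by simp
        then show False
          using unity_root_bij[OF n] ij False by (auto simp: bij_betw_def dest: inj_onD)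
      qed
      moreover have "z ^ n = 1"
        using unity_root_period[OF n, of i] unity_root_period[OF n, of j]
        by (simp add: z_def power_mult_distrib flip: unity_root_mult complex_cnj_power)
          (simp add: mult.commute)
      ultimately show ?thesis
        using False by (simp add: geometric_sum)
    qed
    finally show "(fourier_mat n * ?W') $$ (i, j) = (of_nat n \<cdot>\<^sub>m 1\<^sub>m n) $$ (i, j)"
      using ij by simp
  qed (auto simp: fourier_mat_def)
  then have "det (fourier_mat n) * det ?W' = of_nat n ^ n"
    by (subst det_mult[symmetric, of _ n]) auto
  then show ?thesis
    using n by auto
qed

text \<open>
  The adjacency matrix of the circulant multigraph with an edge from \<open>i\<close> to \<open>i + l\<close> for each \<open>i\<close>
  modulo \<open>n\<close>. If \<open>2 * l\<close> is a multiple of \<open>n\<close>, both indicators agree and the entries 2 count the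
  parallel edges.
\<close>

definition cycle_mat :: "nat \<Rightarrow> nat \<Rightarrow> complex mat" where
  "cycle_mat n l = mat n n (\<lambda>(i, j). of_bool ((i + l) mod n = j) + of_bool ((j + l) mod n = i))"

lemma cycle_mat_carrier [simp]: "cycle_mat n l \<in> carrier_mat n n"
  by (simp add: cycle_mat_def)

lemma mod_shift_inverse:
  fixes i j l n :: nat
  assumes "i < n" "j < n"
  shows "(j + l) mod n = i \<longleftrightarrow> j = (i + (n - l mod n)) mod n"
proof -
  have wrap: "a mod n = (if a < n then a else a - n)" if "a < 2 * n" for a
    using that by (simp add: le_mod_geq)
  define l' where "l' = l mod n"
  have l': "l' < n"
    using assms by (simp add: l'_def)
  have "(j + l) mod n = (j + l') mod n"
    by (simp add: l'_def mod_add_right_eq)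
  also have "\<dots> = (if j + l' < n then j + l' else j + l' - n)"
    using assms l' by (intro wrap) simp
  finally have j: "(j + l) mod n = (if j + l' < n then j + l' else j + l' - n)" .
  have "(i + (n - l')) mod n = (if i < l' then i + (n - l') else i - l')"
    using assms l' by (subst wrap) auto
  with j show ?thesis
    using assms l' unfolding l'_def[symmetric] by (simp, linarith)
qed

text \<open>
  Shifting the index by \<open>l\<close> multiplies the \<open>m\<close>-th character by \<open>unity_root n (l * m)\<close>, shifting back
  multiplies it by the conjugate.
\<close>

lemma cycle_mat_eigen:
  assumes n: "n > 0"
  shows "cycle_mat n l * fourier_mat n =
    fourier_mat n * mat_diag n (\<lambda>m. of_real (2 * cos (2 * pi * real (l * m) / real n)))"
proof (rule eq_matI)
  fix i m
  assume "i < dim_row (fourier_mat n * mat_diag n (\<lambda>m. of_real (2 * cos (2 * pi * real (l * m) / real n))))"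
    and "m < dim_col (fourier_mat n * mat_diag n (\<lambda>m. of_real (2 * cos (2 * pi * real (l * m) / real n))))"
  then have im: "i < n" "m < n"
    by (auto simp: fourier_mat_def mat_diag_def)
  define i' where "i' = (i + (n - l mod n)) mod n"
  have i': "i' < n" "(i' + l) mod n = i"
    using mod_shift_inverse[of i n i' l] im n by (auto simp: i'_def)
  let ?w = "\<lambda>j. unity_root n (j * m)"
  have "(cycle_mat n l * fourier_mat n) $$ (i, m) =
      (\<Sum>j = 0..<n. (of_bool ((i + l) mod n = j) + of_bool ((j + l) mod n = i)) * ?w j)"
    using im by (simp add: cycle_mat_def fourier_mat_def scalar_prod_def)
  also have "\<dots> = (\<Sum>j = 0..<n. (if (i + l) mod n = j then ?w j else 0) + (if i' = j then ?w j else 0))"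
  proof (intro sum.cong refl)
    fix j
    assume "j \<in> {0..<n}"
    then show "(of_bool ((i + l) mod n = j) + of_bool ((j + l) mod n = i)) * ?w j =
        (if (i + l) mod n = j then ?w j else 0) + (if i' = j then ?w j else 0)"
      using mod_shift_inverse[of i n j l] im by (auto simp: i'_def)
  qed
  also have "\<dots> = ?w ((i + l) mod n) + ?w i'"
    using n i' by (simp add: sum.distrib)
  also have "?w ((i + l) mod n) = ?w i * ?w l"
    using n by (simp add: unity_root_mod_mult add_mult_distrib unity_root_add)
  also have "?w i' = ?w i * cnj (?w l)"
  proof -
    have "?w i = ?w (i' + l)"
      using unity_root_mod_mult[OF n, of "i' + l" m] i' by simp
    also have "\<dots> = ?w i' * ?w l"
      by (simp add: add_mult_distrib unity_root_add)
    finally show ?thesis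
      using unity_root_cnj[of n "l * m"] by (simp add: mult.assoc)
  qed
  also have "?w i * ?w l + ?w i * cnj (?w l) = ?w i * of_real (2 * cos (2 * pi * real (l * m) / real n))"
    by (simp only: ring_distribs(1)[symmetric] unity_root_add_cnj)
  also have "\<dots> = (fourier_mat n * mat_diag n (\<lambda>m. of_real (2 * cos (2 * pi * real (l * m) / real n)))) $$ (i, m)"
    using im by (subst mat_diag_mult_right[of _ n]) (auto simp: fourier_mat_def)
  finally show "(cycle_mat n l * fourier_mat n) $$ (i, m) =
      (fourier_mat n * mat_diag n (\<lambda>m. of_real (2 * cos (2 * pi * real (l * m) / real n)))) $$ (i, m)" .
qed (auto simp: cycle_mat_def fourier_mat_def mat_diag_def)

lemma det_diagonalised:
  fixes M :: "'a :: idom mat"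
  assumes M: "M \<in> carrier_mat n n" and W: "W \<in> carrier_mat n n" "det W \<noteq> 0"
    and eig: "M * W = W * mat_diag n f"
  shows "det M = (\<Prod>m < n. f m)"
proof -
  have "det (mat_diag n f) = prod_list (diag_mat (mat_diag n f))"
    by (rule det_upper_triangular[of _ n]) (auto simp: mat_diag_def upper_triangular_def)
  also have "\<dots> = (\<Prod>m < n. f m)"
    unfolding prod_list_diag_prod by (simp add: mat_diag_def atLeast0LessThan)
  finally have "det (mat_diag n f) = (\<Prod>m < n. f m)" .
  moreover have "det W * det M = det (M * W)"
    by (simp only: det_mult[OF M W(1)] mult.commute)
  then have "det W * det M = det W * det (mat_diag n f)"
    unfolding eig by (simp only: det_mult[OF W(1) mat_diag_dim])
  then have "det M = det (mat_diag n f)"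
    using W(2) by simp
  ultimately show ?thesis
    by simp
qed

text \<open>
  The blocks commute, so the determinant is that of the product of the diagonal blocks minus the
  identity, and the Fourier matrix diagonalises both blocks at once.
\<close>

lemma det_cycle_block:
  assumes n: "n > 0"
  shows "det (four_block_mat (x \<cdot>\<^sub>m 1\<^sub>m n + cycle_mat n l) (1\<^sub>m n) (1\<^sub>m n) (x \<cdot>\<^sub>m 1\<^sub>m n + cycle_mat n k)) =
    (\<Prod>m < n. (x + of_real (2 * cos (2 * pi * real (l * m) / real n))) *
      (x + of_real (2 * cos (2 * pi * real (k * m) / real n))) - 1)"
proof -
  let ?W = "fourier_mat n"
  define a where "a l m = x + complex_of_real (2 * cos (2 * pi * real (l * m) / real n))" for l m
  define A where "A l = x \<cdot>\<^sub>m 1\<^sub>m n + cycle_mat n l" for l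
  have Ac: "A l \<in> carrier_mat n n" for l
    by (simp add: A_def)
  have AW: "A l * ?W = ?W * mat_diag n (a l)" for l
  proof -
    have "A l * ?W = x \<cdot>\<^sub>m ?W + cycle_mat n l * ?W"
      unfolding A_def
      by (subst add_mult_distrib_mat[of _ n n _ _ n])
        (auto simp: mult_smult_assoc_mat[of _ n n _ n] fourier_mat_def)
    also have "\<dots> = ?W * mat_diag n (a l)"
      unfolding cycle_mat_eigen[OF n] mat_diag_mult_right[OF fourier_mat_carrier]
      by (rule eq_matI) (auto simp: a_def ring_distribs fourier_mat_def)
    finally show ?thesis .
  qed
  have "det (four_block_mat (A l) (1\<^sub>m n) (1\<^sub>m n) (A k)) = det (A l * A k - 1\<^sub>m n)"
    using Ac by (subst det_four_block_mat[of _ n]) (auto simp: left_mult_one_mat[OF Ac] right_mult_one_mat[OF Ac])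
  also have "\<dots> = (\<Prod>m < n. a l m * a k m - 1)"
  proof (rule det_diagonalised[of _ n ?W])
    have "(A l * A k - 1\<^sub>m n) * ?W = A l * (A k * ?W) - ?W"
      by (simp add: minus_mult_distrib_mat[OF mult_carrier_mat[OF Ac Ac] one_carrier_mat fourier_mat_carrier]
          assoc_mult_mat[OF Ac Ac fourier_mat_carrier] left_mult_one_mat[OF fourier_mat_carrier])
    also have "\<dots> = A l * ?W * mat_diag n (a k) - ?W"
      by (subst AW[of k], subst assoc_mult_mat[OF Ac[of l] fourier_mat_carrier mat_diag_dim]) (rule refl)
    also have "\<dots> = ?W * mat_diag n (\<lambda>m. a l m * a k m) - ?W"
      unfolding AW by (simp add: assoc_mult_mat[OF fourier_mat_carrier mat_diag_dim mat_diag_dim])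
    also have "\<dots> = ?W * mat_diag n (\<lambda>m. a l m * a k m - 1)"
      unfolding mat_diag_mult_right[OF fourier_mat_carrier]
      by (rule eq_matI) (auto simp: right_diff_distrib fourier_mat_def)
    finally show "(A l * A k - 1\<^sub>m n) * ?W = ?W * mat_diag n (\<lambda>m. a l m * a k m - 1)" .
  qed (use Ac det_fourier_mat_nonzero[OF n] in auto)
  finally show ?thesis
    by (simp add: A_def a_def)
qed

section \<open>Products over the roots of Chebyshev polynomials\<close>

lemma cheb_0: "cheb 0 = 1"
  by (rule cheb_unique[where c = "\<lambda>\<phi>. of_real (cos (real 0 * \<phi>))"]) (simp_all add: poly_cheb_cos)

lemma cheb_1: "cheb (Suc 0) = [:0, 1:]"
  by (rule cheb_unique[where c = "\<lambda>\<phi>. of_real (cos \<phi>)"]) (simp_all add: poly_cheb_cos)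

lemma cheb_rec: "cheb (Suc (Suc j)) = [:0, 2:] * cheb (Suc j) - cheb j"
proof (rule cheb_unique)
  fix \<phi> :: real
  define a where "a = real (Suc j) * \<phi>"
  have "real (Suc (Suc j)) * \<phi> = a + \<phi>" "real j * \<phi> = a - \<phi>"
    by (simp_all add: a_def algebra_simps)
  then show "poly ([:0, 2:] * cheb (Suc j) - cheb j) (of_real (cos \<phi>)) =
      of_real (cos (real (Suc (Suc j)) * \<phi>))"
    by (simp del: of_nat_Suc add: poly_cheb_cos a_def[symmetric] cos_add cos_diff)
qed (rule poly_cheb_cos)

lemma degree_diff_lower: "degree q < degree p \<Longrightarrow> degree (p - q) = degree (p :: 'a :: ab_group_add poly)"
  using degree_add_eq_left[of "- q" p] by simp

lemma cheb_degree_lead_coeff: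
  "degree (cheb (Suc j)) = Suc j \<and> lead_coeff (cheb (Suc j)) = 2 ^ j"
proof (induction j rule: less_induct)
  case (less j)
  consider "j = 0" | i where "j = Suc i"
    by (cases j) auto
  then show ?case
  proof cases
    case 1
    then show ?thesis by (simp add: cheb_1)
  next
    case (2 i)
    have prev: "degree (cheb (Suc i)) = Suc i" "lead_coeff (cheb (Suc i)) = 2 ^ i"
      using less[of i] 2 by auto
    have low: "degree (cheb i) < Suc (Suc i)"
      using less[of "i - 1"] 2 by (cases i) (auto simp: cheb_0)
    have ne: "cheb (Suc i) \<noteq> 0"
      using prev by auto
    have deg: "degree ([:0, 2:] * cheb (Suc i)) = Suc (Suc i)"
      using ne prev by (subst degree_mult_eq) auto
    have "degree (cheb (Suc (Suc i))) = Suc (Suc i)"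
      unfolding cheb_rec using deg low by (subst degree_diff_lower) auto
    moreover have "coeff (cheb (Suc (Suc i))) (Suc (Suc i)) = 2 ^ Suc i"
      using low prev by (simp add: cheb_rec coeff_eq_0)
    ultimately show ?thesis
      using 2 by simp
  qed
qed

lemma poly_cheb_1: "poly (cheb j) 1 = 1"
  using poly_cheb_cos[of j 0] by simp

text \<open>
  This derivative serves twice: it evaluates the product of \<open>1 - cos (2 * pi * j / n)\<close> over
  \<open>0 < j < n\<close>, and it shows that 1 is not a root of \<open>Q_poly k l\<close>.
\<close>

lemma poly_pderiv_cheb_1: "poly (pderiv (cheb j)) 1 = of_nat (j\<^sup>2)"
proof (induction j rule: less_induct)
  case (less j)
  consider "j = 0" | "j = 1" | i where "j = Suc (Suc i)"
    by (metis One_nat_def old.nat.exhaust)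
  then show ?case
  proof cases
    case (3 i)
    then show ?thesis
      using less[of i] less[of "Suc i"]
      by (simp add: cheb_rec pderiv_diff pderiv_smult pderiv_pCons poly_cheb_1 power2_eq_square algebra_simps)
  qed (simp_all add: cheb_0 cheb_1 pderiv_pCons)
qed

definition cheb_node :: "nat \<Rightarrow> nat \<Rightarrow> complex" where
  "cheb_node n j = of_real (cos (2 * pi * real j / real n))"

text \<open>
  With \<open>z = cis \<phi>\<close> and \<open>w\<close> ranging over the \<open>n\<close>-th roots of unity,
  \<open>(z - w) * (z - cnj w) = z * (2 * cos \<phi> - 2 * Re w)\<close>. Multiplying over all \<open>w\<close> turns the left side
  into \<open>(z ^ n - 1)\<^sup>2 = z ^ n * (2 * cos (n * \<phi>) - 2)\<close>.
\<close>

lemma cheb_minus_1_factor: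
  assumes n: "n > 0"
  shows "cheb n - 1 = Polynomial.smult (2 ^ (n - 1)) (\<Prod>j < n. [:- cheb_node n j, 1:])"
proof (rule cheb_unique)
  fix \<phi> :: real
  show "poly (cheb n - 1) (of_real (cos \<phi>)) = of_real (cos (real n * \<phi>) - 1)"
    by (simp add: poly_cheb_cos)
next
  fix \<phi> :: real
  define w where "w j = cis (2 * pi * real j / real n)" for j
  define z where "z = cis \<phi>"
  have roots: "(\<Prod>j < n. z - w j) = z ^ n - 1" for z
  proof -
    let ?p = "monom 1 n - 1 :: complex poly"
    have deg: "degree ?p = n" "lead_coeff ?p = 1"
      using n by (simp_all add: degree_diff_lower degree_monom_eq)
    have ne: "?p \<noteq> 0"
      using deg(1) n by (metis degree_0 less_irrefl)
    have "rsquarefree ?p"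
      unfolding rsquarefree_roots using n
      by (auto simp: pderiv_diff pderiv_monom poly_monom power_0_left)
    then have "(\<Prod>z | poly ?p z = 0. [:- z, 1:]) = ?p"
      using complex_poly_decompose_rsquarefree[of ?p] deg by simp
    moreover have "{z. poly ?p z = 0} = {z. z ^ n = 1}"
      by (auto simp: poly_monom)
    ultimately have "(\<Prod>z \<in> {z. z ^ n = 1}. [:- z, 1:]) = ?p"
      by simp
    moreover have "(\<Prod>j < n. [:- w j, 1:]) = (\<Prod>z \<in> {z. z ^ n = 1}. [:- z, 1:])"
      unfolding w_def by (rule prod.reindex_bij_betw[OF bij_betw_roots_unity[OF n]])
    ultimately have "poly (\<Prod>j < n. [:- w j, 1:]) z = poly ?p z"
      by simp
    then show ?thesis
      by (simp add: poly_prod poly_monom)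
  qed
  have roots': "(\<Prod>j < n. z - cnj (w j)) = z ^ n - 1" for z
  proof -
    have "(\<Prod>j < n. z - cnj (w j)) = cnj (\<Prod>j < n. cnj z - w j)"
      by simp
    also have "\<dots> = z ^ n - 1"
      unfolding roots by simp
    finally show ?thesis .
  qed
  have zcnj: "z * cnj z = 1"
    by (simp add: z_def cis_cnj cis_mult)
  have "z ^ n * (2 ^ n * (\<Prod>j < n. of_real (cos \<phi>) - cheb_node n j)) =
      (\<Prod>j < n. z * (2 * (of_real (cos \<phi>) - cheb_node n j)))"
    by (simp only: prod.distrib prod_constant card_lessThan)
  also have "\<dots> = (\<Prod>j < n. (z - w j) * (z - cnj (w j)))"
  proof (rule prod.cong[OF refl])
    fix j
    have "2 * complex_of_real (cos \<phi>) = z + cnj z" "2 * cheb_node n j = w j + cnj (w j)"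
      by (simp_all add: z_def w_def cheb_node_def complex_eq_iff)
    then have "z * (2 * (of_real (cos \<phi>) - cheb_node n j)) = z * (z + cnj z - (w j + cnj (w j)))"
      by (simp add: right_diff_distrib)
    also have "\<dots> = z * z + z * cnj z - z * w j - z * cnj (w j)"
      by (simp add: algebra_simps)
    also have "z * cnj z = w j * cnj (w j)"
      unfolding zcnj by (simp add: w_def cis_cnj cis_mult)
    finally show "z * (2 * (of_real (cos \<phi>) - cheb_node n j)) = (z - w j) * (z - cnj (w j))"
      by (simp add: algebra_simps)
  qed
  also have "\<dots> = (z ^ n - 1) * (z ^ n - 1)"
    by (simp add: prod.distrib roots roots')
  also have "\<dots> = z ^ n * (z ^ n + cnj z ^ n - 2)"
  proof -
    have "z ^ n * cnj z ^ n = 1"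
      by (simp add: zcnj flip: power_mult_distrib)
    then show ?thesis
      by (simp add: algebra_simps)
  qed
  also have "z ^ n + cnj z ^ n = of_real (2 * cos (real n * \<phi>))"
    by (simp add: z_def cis_cnj DeMoivre complex_eq_iff)
  finally have "2 ^ n * (\<Prod>j < n. of_real (cos \<phi>) - cheb_node n j) = of_real (2 * cos (real n * \<phi>)) - 2"
    using zcnj by auto
  moreover have "(2 :: complex) ^ n = 2 * 2 ^ (n - 1)"
    using n by (cases n) auto
  ultimately have "2 * (2 ^ (n - 1) * (\<Prod>j < n. of_real (cos \<phi>) - cheb_node n j)) =
      2 * (complex_of_real (cos (real n * \<phi>)) - 1)"
    by (simp add: mult.assoc right_diff_distrib del: One_nat_def)
  then have "2 ^ (n - 1) * (\<Prod>j < n. of_real (cos \<phi>) - cheb_node n j) =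
      complex_of_real (cos (real n * \<phi>)) - 1"
    by (simp only: mult_cancel_left) simp
  then show "poly (Polynomial.smult (2 ^ (n - 1)) (\<Prod>j < n. [:- cheb_node n j, 1:])) (of_real (cos \<phi>)) =
      of_real (cos (real n * \<phi>) - 1)"
    by (simp add: poly_prod)
qed

text \<open>
  The quotient of \<open>poly (cheb n) w - 1\<close> by \<open>w - 1\<close>, continued to \<open>w = 1\<close>: the node with index 0
  is 1 and is left out of the product.
\<close>

definition cheb_quot :: "nat \<Rightarrow> complex \<Rightarrow> complex" where
  "cheb_quot n w = 2 ^ (n - 1) * (\<Prod>j = 1..<n. w - cheb_node n j)"

lemma cheb_quot_mult:
  assumes n: "n > 0"
  shows "poly (cheb n) w - 1 = (w - 1) * cheb_quot n w"
proof -
  have "poly (cheb n - 1) w = 2 ^ (n - 1) * (\<Prod>j < n. w - cheb_node n j)"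
    unfolding cheb_minus_1_factor[OF n] by (simp add: poly_prod)
  also have "{..<n} = insert 0 {1..<n}"
    using n by auto
  finally show ?thesis
    by (simp add: cheb_quot_def cheb_node_def)
qed

text \<open>
  At 1 the quotient by \<open>w - 1\<close> is the derivative of \<open>cheb n\<close>.
\<close>

lemma cheb_quot_1:
  assumes n: "n > 0"
  shows "cheb_quot n 1 = of_nat (n\<^sup>2)"
proof -
  define R where "R = Polynomial.smult (2 ^ (n - 1)) (\<Prod>j = 1..<n. [:- cheb_node n j, 1:])"
  have R: "poly R w = cheb_quot n w" for w
    by (simp add: R_def cheb_quot_def poly_prod)
  have "cheb n - 1 = [:-1, 1:] * R"
    by (rule poly_ext) (use cheb_quot_mult[OF n] in \<open>simp add: R algebra_simps\<close>)
  then have "pderiv (cheb n - 1) = pderiv ([:-1, 1:] * R)"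
    by simp
  then have "poly (pderiv (cheb n)) 1 = poly (pderiv ([:-1, 1:] * R)) 1"
    by (simp add: pderiv_diff)
  moreover have "poly (pderiv ([:-1, 1:] * R)) 1 = poly R 1"
    unfolding pderiv_mult by (simp add: pderiv_pCons)
  ultimately show ?thesis
    by (simp add: poly_pderiv_cheb_1 R)
qed

lemma Q_poly_mult: "(w - 1) * poly (Q_poly k l) w = (3 - 2 * poly (cheb k) w) * (3 - 2 * poly (cheb l) w) - 1"
  using arg_cong[OF Q_poly_exact[of k l], of "\<lambda>p. poly p w"] by (simp add: algebra_simps)

lemma Q_poly_degree_lead_coeff:
  assumes k: "k > 0" and l: "l > 0"
  shows "degree (Q_poly k l) = k + l - 1" "lead_coeff (Q_poly k l) = 2 ^ (k + l)"
proof -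
  have factor: "degree (3 - 2 * cheb j) = j \<and> lead_coeff (3 - 2 * cheb j) = - (2 ^ j)" if "j > 0" for j
  proof -
    obtain i where i: "j = Suc i"
      using \<open>j > 0\<close> by (cases j) auto
    have d: "degree (cheb j) = j" "coeff (cheb j) j = 2 ^ i"
      using cheb_degree_lead_coeff[of i] i by auto
    have eq: "3 - 2 * cheb j = [:3:] - Polynomial.smult 2 (cheb j)"
      by (simp add: numeral_poly)
    have "degree (3 - 2 * cheb j) = j"
      unfolding eq using d that degree_add_eq_right[of "[:3:]" "- Polynomial.smult 2 (cheb j)"] by simp
    moreover have "coeff (3 - 2 * cheb j) j = - (2 ^ j)"
      unfolding eq using d i by (simp add: coeff_pCons)
    ultimately show ?thesis by simp
  qed
  let ?P = "(3 - 2 * cheb k) * (3 - 2 * cheb l)"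
  have degP: "degree ?P = k + l"
    using factor[OF k] factor[OF l] by (subst degree_mult_eq) auto
  have lcP: "coeff ?P (k + l) = 2 ^ (k + l)"
    using lead_coeff_mult[of "3 - 2 * cheb k" "3 - 2 * cheb l"]
    unfolding degP conjunct2[OF factor[OF k]] conjunct2[OF factor[OF l]] by (simp add: power_add)
  have deg1: "degree (?P - 1) = k + l"
    using degP k by (subst degree_diff_lower) auto
  have lc1: "lead_coeff (?P - 1) = 2 ^ (k + l)"
    unfolding deg1 using lcP k by simp
  have ne: "Q_poly k l \<noteq> 0"
    using Q_poly_exact[of k l] lc1 by auto
  have "degree (Q_poly k l * [:-1, 1:]) = degree (Q_poly k l) + 1"
    using ne by (subst degree_mult_eq) auto
  then show "degree (Q_poly k l) = k + l - 1"
    using deg1 Q_poly_exact[of k l] by simp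
  show "lead_coeff (Q_poly k l) = 2 ^ (k + l)"
    using lc1 unfolding Q_poly_exact[of k l, symmetric] lead_coeff_mult by simp
qed

text \<open>
  The value at 1 is the derivative of \<open>(3 - 2 * cheb k) * (3 - 2 * cheb l)\<close> there, which is
  \<open>- 2 * (k\<^sup>2 + l\<^sup>2)\<close>. Hence no root of \<open>Q_poly k l\<close> makes a denominator \<open>w - 1\<close> vanish.
\<close>

lemma Q_poly_1_nonzero:
  assumes "k > 0"
  shows "poly (Q_poly k l) 1 \<noteq> 0"
proof -
  have "pderiv (Q_poly k l * [:-1, 1:]) = pderiv ((3 - 2 * cheb k) * (3 - 2 * cheb l) - 1)"
    unfolding Q_poly_exact ..
  then have "poly (pderiv (Q_poly k l * [:-1, 1:])) 1 =
      poly (pderiv ((3 - 2 * cheb k) * (3 - 2 * cheb l) - 1)) 1"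
    by simp
  then have "poly (Q_poly k l) 1 = - 2 * of_nat (k\<^sup>2) - 2 * of_nat (l\<^sup>2)"
    by (simp add: pderiv_mult pderiv_diff pderiv_pCons poly_cheb_1 poly_pderiv_cheb_1 del: of_nat_power)
  also have "\<dots> = - of_nat (2 * (k\<^sup>2 + l\<^sup>2))"
    by simp
  also have "\<dots> \<noteq> 0"
    using assms by (simp del: of_nat_mult of_nat_add)
  finally show ?thesis .
qed

text \<open>
  Each factor on the left is the value of \<open>(w - 1) * Q_poly k l\<close> at a node. With \<open>Q_poly k l\<close> split
  into linear factors, the left side becomes a double product over nodes and roots, and multiplying
  over the nodes first gives the values of \<open>cheb_quot n\<close> at 1 and at the roots. Signs and powers of
  two collect in \<open>s\<close> and \<open>c\<close>; each of the \<open>k + l\<close> products over the nodes contributes \<open>s / c\<close>, and the leading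
  coefficient contributes \<open>c ^ (k + l)\<close>.
\<close>

theorem prod_Q_poly_nodes:
  assumes n: "n > 0" and k: "k > 0" and l: "l > 0"
  shows "(\<Prod>j = 1..<n. (3 - 2 * poly (cheb k) (cheb_node n j)) * (3 - 2 * poly (cheb l) (cheb_node n j)) - 1) =
    (-1) ^ ((n - 1) * (k + l)) * of_nat (n\<^sup>2) *
      (\<Prod>w \<in># proots (Q_poly k l). (poly (cheb n) w - 1) / (w - 1))"
proof -
  let ?Q = "Q_poly k l"
  let ?J = "{1..<n}"
  define c :: complex where "c = 2 ^ (n - 1)"
  define s :: complex where "s = (-1) ^ (n - 1)"
  have c0: "c \<noteq> 0"
    by (simp add: c_def)
  have quot: "(poly (cheb n) w - 1) / (w - 1) = cheb_quot n w" if "w \<in># proots ?Q" for w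
  proof -
    have "?Q \<noteq> 0"
      using Q_poly_1_nonzero[OF k, of l] by auto
    then have "poly ?Q w = 0"
      using that by simp
    then have "w \<noteq> 1"
      using Q_poly_1_nonzero[OF k, of l] by auto
    then show ?thesis
      using cheb_quot_mult[OF n, of w] by simp
  qed
  have flip: "(\<Prod>j \<in> ?J. cheb_node n j - w) = s / c * cheb_quot n w" for w
  proof -
    have "(\<Prod>j \<in> ?J. cheb_node n j - w) = (\<Prod>j \<in> ?J. (-1) * (w - cheb_node n j))"
      by simp
    also have "\<dots> = s * (\<Prod>j \<in> ?J. w - cheb_node n j)"
      unfolding prod.distrib by (simp add: s_def)
    finally show ?thesis
      using c0 by (simp add: cheb_quot_def c_def)
  qed
  have Q: "poly ?Q x = 2 ^ (k + l) * (\<Prod>w \<in># proots ?Q. x - w)" for x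
  proof -
    have "poly ?Q x = poly (Polynomial.smult (lead_coeff ?Q) (\<Prod>w \<in># proots ?Q. [:- w, 1:])) x"
      by (simp only: complex_poly_decompose_multiset)
    also have "\<dots> = 2 ^ (k + l) * (\<Prod>w \<in># proots ?Q. x - w)"
      unfolding Q_poly_degree_lead_coeff(2)[OF k l]
      by (simp add: poly_prod_mset image_mset.compositionality o_def)
    finally show ?thesis .
  qed
  have size: "size (proots ?Q) = k + l - 1"
    using size_proots_complex[of ?Q] Q_poly_degree_lead_coeff(1)[OF k l] by simp
  have swap: "(\<Prod>j \<in> ?J. \<Prod>w \<in># M. cheb_node n j - w) = (\<Prod>w \<in># M. \<Prod>j \<in> ?J. cheb_node n j - w)" for M
    by (induction M) (simp_all add: prod.distrib)
  have "(\<Prod>j \<in> ?J. (3 - 2 * poly (cheb k) (cheb_node n j)) * (3 - 2 * poly (cheb l) (cheb_node n j)) - 1) =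
      (\<Prod>j \<in> ?J. (cheb_node n j - 1) * (2 ^ (k + l) * (\<Prod>w \<in># proots ?Q. cheb_node n j - w)))"
    unfolding Q[symmetric] Q_poly_mult ..
  also have "\<dots> = (\<Prod>j \<in> ?J. cheb_node n j - 1) * c ^ (k + l) *
      (\<Prod>j \<in> ?J. \<Prod>w \<in># proots ?Q. cheb_node n j - w)"
    by (simp add: prod.distrib c_def mult.commute flip: power_mult)
  also have "(\<Prod>j \<in> ?J. \<Prod>w \<in># proots ?Q. cheb_node n j - w) =
      (\<Prod>w \<in># proots ?Q. \<Prod>j \<in> ?J. cheb_node n j - w)"
    by (rule swap)
  also have "\<dots> = (\<Prod>w \<in># proots ?Q. s / c) * (\<Prod>w \<in># proots ?Q. cheb_quot n w)"
    unfolding flip by (rule prod_mset.distrib)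
  also have "(\<Prod>w \<in># proots ?Q. s / c) = (s / c) ^ (k + l - 1)"
    by (simp add: size)
  also have "(\<Prod>w \<in># proots ?Q. cheb_quot n w) = (\<Prod>w \<in># proots ?Q. (poly (cheb n) w - 1) / (w - 1))"
    using quot by (intro arg_cong[where f = prod_mset] image_mset_cong) simp
  also have "(\<Prod>j \<in> ?J. cheb_node n j - 1) = s / c * of_nat (n\<^sup>2)"
    by (simp only: flip cheb_quot_1[OF n])
  also have "s / c * of_nat (n\<^sup>2) * c ^ (k + l) *
      ((s / c) ^ (k + l - 1) * (\<Prod>w \<in># proots ?Q. (poly (cheb n) w - 1) / (w - 1))) =
      (s / c * (s / c) ^ (k + l - 1) * c ^ (k + l)) * of_nat (n\<^sup>2) *
        (\<Prod>w \<in># proots ?Q. (poly (cheb n) w - 1) / (w - 1))"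
    by (simp only: mult_ac)
  also have "s / c * (s / c) ^ (k + l - 1) * c ^ (k + l) = s ^ (k + l)"
  proof -
    have "s / c * (s / c) ^ (k + l - 1) = (s / c) ^ (k + l)"
      using k by (cases "k + l") auto
    then show ?thesis
      using c0 by (simp add: power_divide)
  qed
  also have "s ^ (k + l) = (-1) ^ ((n - 1) * (k + l))"
    by (simp add: s_def power_mult)
  finally show ?thesis .
qed

section \<open>Spanning trees of I-graphs\<close>

text \<open>
  The derivative of a characteristic polynomial is the sum of those of the principal submatrices.
  At 0 each of these is, up to sign, the determinant of a reduced Laplacian, which by the matrix-tree
  theorem is the same for every choice of the root vertex. This makes the number of spanning
  trees readable from the eigenvalues.
\<close>

lemma (in finite_multigraph) pderiv_char_poly_laplacian:
  assumes h: "bij_betw h {0..<N} (verts G)"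
  shows "poly (pderiv (char_poly (mat N N (\<lambda>(i, j). laplacian G (h i) (h j)) :: 'a :: field mat))) 0 =
    (-1) ^ (N - 1) * of_nat N * of_nat (num_spanning_trees G)"
proof -
  let ?L = "mat N N (\<lambda>(i, j). laplacian G (h i) (h j)) :: 'a mat"
  have "poly (char_poly (mat_delete ?L r r)) 0 = (-1) ^ (N - 1) * of_nat (num_spanning_trees G)"
    if r: "r < N" for r
  proof -
    let ?h = "\<lambda>i. h (insert_index r i)"
    have "bij_betw (insert_index r) {0..<N - 1} ({0..<N} - {r})"
      using insert_index_image[of r "N - 1"] r
      by (auto simp: bij_betw_def insert_index_inj_on)
    moreover have "bij_betw h ({0..<N} - {r}) (verts G - {h r})"
      using r h by (intro bij_betw_DiffI h) (auto simp: bij_betw_def)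
    ultimately have bij: "bij_betw ?h {0..<N - 1} (verts G - {h r})"
      using bij_betw_trans by (fastforce simp: o_def)
    let ?D = "mat (N - 1) (N - 1) (\<lambda>(i, j). laplacian G (?h i) (?h j)) :: 'a mat"
    have "mat_delete ?L r r = ?D"
      unfolding mat_delete_def insert_index_def using r by (intro eq_matI) auto
    moreover have "poly (char_poly ?D) 0 = det ((-1) \<cdot>\<^sub>m ?D)"
      unfolding char_poly_def char_poly_matrix_def
      by (rule poly_det_cong[of _ "N - 1"]) auto
    moreover have "h r \<in> verts G"
      using h r by (auto simp: bij_betw_def)
    ultimately show ?thesis
      using matrix_tree[OF _ bij] by simp
  qed
  then show ?thesis
    by (simp add: pderiv_char_poly[of _ N] poly_sum)
qed

lemma I_graph_simps [simp]:
  "verts (I_graph n k l) = U ` {..<n} \<union> V ` {..<n}"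
  "edges (I_graph n k l) = UU ` {..<n} \<union> UV ` {..<n} \<union> VV ` {..<n}"
  "ends (I_graph n k l) = I_ends n k l"
  by (simp_all add: I_graph_def)

lemma finite_multigraph_I_graph:
  assumes "n > 0"
  shows "finite_multigraph (I_graph n k l)"
proof
  fix e
  assume "e \<in> edges (I_graph n k l)"
  then show "\<exists>x \<in> verts (I_graph n k l). \<exists>y \<in> verts (I_graph n k l). ends (I_graph n k l) e = {x, y}"
    using assms by fastforce
qed simp_all

lemma mod_shift_neq:
  fixes n l i :: nat
  assumes "\<not> n dvd l"
  shows "(i + l) mod n \<noteq> i"
proof
  assume eq: "(i + l) mod n = i"
  then have "(i + l) mod n = i mod n"
    by (metis mod_mod_trivial)
  then have "n dvd l"
    using mod_eq_dvd_iff_nat[of i "i + l" n] by simp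
  with assms show False ..
qed

text \<open>
  The vertex \<open>U i\<close> is on the two outer edges that start and end at index \<open>i\<close>. They are different
  labels because \<open>n\<close> does not divide \<open>l\<close>, even when they have the same ends.
\<close>

lemma laplacian_I_graph_U:
  assumes i: "i < n" and l: "\<not> n dvd l"
  shows "laplacian (I_graph n k l) (U i) (U j) =
      (3 * of_bool (i = j) - of_bool ((i + l) mod n = j) - of_bool (j < n \<and> (j + l) mod n = i) :: 'a :: field)"
    and "laplacian (I_graph n k l) (U i) (V j) = (- of_bool (i = j) :: 'a)"
proof -
  define i' where "i' = (i + (n - l mod n)) mod n"
  have i': "(j + l) mod n = i \<longleftrightarrow> j = i'" if "j < n" for j
    using mod_shift_inverse[OF i that] by (simp add: i'_def)
  have "i' < n"
    using i by (simp add: i'_def)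
  then have i'_l: "(i' + l) mod n = i"
    using i' by simp
  have i'_eq: "i = (j + l) mod n \<longleftrightarrow> j = i'" if "j < n" for j
    using i'[OF that] by auto
  have "i' \<noteq> i"
    using mod_shift_neq[OF l, of i] i'_l by auto
  have inc: "incident (I_graph n k l) (U i) = {UU i, UV i, UU i'}"
    using i \<open>i' < n\<close> by (auto simp: incident_def i'_eq)
  have oe: "other_end (I_graph n k l) (UU i) (U i) = U ((i + l) mod n)"
    "other_end (I_graph n k l) (UV i) (U i) = V i"
    "other_end (I_graph n k l) (UU i') (U i) = U i'"
    using i'_l by (auto intro!: other_end_eq)
  show "laplacian (I_graph n k l) (U i) (U j) =
      (3 * of_bool (i = j) - of_bool ((i + l) mod n = j) - of_bool (j < n \<and> (j + l) mod n = i) :: 'a)"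
    using \<open>i' \<noteq> i\<close> i' \<open>i' < n\<close> by (auto simp: laplacian_def inc oe)
  show "laplacian (I_graph n k l) (U i) (V j) = (- of_bool (i = j) :: 'a)"
    using \<open>i' \<noteq> i\<close> by (auto simp: laplacian_def inc oe)
qed

lemma laplacian_I_graph_V:
  assumes i: "i < n" and k: "\<not> n dvd k"
  shows "laplacian (I_graph n k l) (V i) (V j) =
      (3 * of_bool (i = j) - of_bool ((i + k) mod n = j) - of_bool (j < n \<and> (j + k) mod n = i) :: 'a :: field)"
    and "laplacian (I_graph n k l) (V i) (U j) = (- of_bool (i = j) :: 'a)"
proof -
  define i' where "i' = (i + (n - k mod n)) mod n"
  have i': "(j + k) mod n = i \<longleftrightarrow> j = i'" if "j < n" for j
    using mod_shift_inverse[OF i that] by (simp add: i'_def)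
  have "i' < n"
    using i by (simp add: i'_def)
  then have i'_k: "(i' + k) mod n = i"
    using i' by simp
  have i'_eq: "i = (j + k) mod n \<longleftrightarrow> j = i'" if "j < n" for j
    using i'[OF that] by auto
  have "i' \<noteq> i"
    using mod_shift_neq[OF k, of i] i'_k by auto
  have inc: "incident (I_graph n k l) (V i) = {VV i, UV i, VV i'}"
    using i \<open>i' < n\<close> by (auto simp: incident_def i'_eq)
  have oe: "other_end (I_graph n k l) (VV i) (V i) = V ((i + k) mod n)"
    "other_end (I_graph n k l) (UV i) (V i) = U i"
    "other_end (I_graph n k l) (VV i') (V i) = V i'"
    using i'_k by (auto intro!: other_end_eq)
  show "laplacian (I_graph n k l) (V i) (V j) =
      (3 * of_bool (i = j) - of_bool ((i + k) mod n = j) - of_bool (j < n \<and> (j + k) mod n = i) :: 'a)"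
    using \<open>i' \<noteq> i\<close> i' \<open>i' < n\<close> by (auto simp: laplacian_def inc oe)
  show "laplacian (I_graph n k l) (V i) (U j) = (- of_bool (i = j) :: 'a)"
    using \<open>i' \<noteq> i\<close> by (auto simp: laplacian_def inc oe)
qed

definition I_vertex_of :: "nat \<Rightarrow> nat \<Rightarrow> I_vertex" where
  "I_vertex_of n i = (if i < n then U i else V (i - n))"

lemma bij_betw_I_vertex_of:
  "bij_betw (I_vertex_of n) {0..<n + n} (verts (I_graph n k l))"
proof (rule bij_betwI[where g = "\<lambda>v. case v of U i \<Rightarrow> i | V i \<Rightarrow> n + i"])
  show "I_vertex_of n \<in> {0..<n + n} \<rightarrow> verts (I_graph n k l)"
    by (auto simp: I_vertex_of_def)
qed (auto simp: I_vertex_of_def)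

text \<open>
  With the vertices \<open>U i\<close> listed before the vertices \<open>V i\<close>, the Laplacian consists of four
  circulant blocks, the spokes giving minus the identity off the diagonal.
\<close>

lemma poly_char_poly_I_graph:
  fixes x :: complex
  assumes n: "n > 0" and k: "\<not> n dvd k" and l: "\<not> n dvd l"
  shows "poly (char_poly (mat (n + n) (n + n)
      (\<lambda>(i, j). laplacian (I_graph n k l) (I_vertex_of n i) (I_vertex_of n j)))) x =
    (\<Prod>m < n. (x - 3 + of_real (2 * cos (2 * pi * real (l * m) / real n))) *
      (x - 3 + of_real (2 * cos (2 * pi * real (k * m) / real n))) - 1)"
proof -
  let ?A = "\<lambda>l. (x - 3) \<cdot>\<^sub>m 1\<^sub>m n + cycle_mat n l"
  have "poly (char_poly (mat (n + n) (n + n)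
      (\<lambda>(i, j). laplacian (I_graph n k l) (I_vertex_of n i) (I_vertex_of n j)))) x =
      det (four_block_mat (?A l) (1\<^sub>m n) (1\<^sub>m n) (?A k))"
    unfolding char_poly_def char_poly_matrix_def
  proof (rule poly_det_cong[of _ "n + n"])
    fix i j
    assume "i < n + n" "j < n + n"
    then show "poly (([:0, 1:] \<cdot>\<^sub>m 1\<^sub>m (dim_row (mat (n + n) (n + n)
          (\<lambda>(i, j). laplacian (I_graph n k l) (I_vertex_of n i) (I_vertex_of n j)))) +
        map_mat (\<lambda>a. [:- a:]) (mat (n + n) (n + n)
          (\<lambda>(i, j). laplacian (I_graph n k l) (I_vertex_of n i) (I_vertex_of n j)))) $$ (i, j)) x =
      four_block_mat (?A l) (1\<^sub>m n) (1\<^sub>m n) (?A k) $$ (i, j)"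
      using n k l
      by (cases "i < n"; cases "j < n")
        (auto simp: I_vertex_of_def laplacian_I_graph_U laplacian_I_graph_V cycle_mat_def)
  qed (auto simp: cycle_mat_def)
  also have "\<dots> = (\<Prod>m < n. (x - 3 + of_real (2 * cos (2 * pi * real (l * m) / real n))) *
      (x - 3 + of_real (2 * cos (2 * pi * real (k * m) / real n))) - 1)"
    by (rule det_cycle_block[OF n])
  finally show ?thesis .
qed

text \<open>
  The eigenvalues of the Laplacian come in pairs, one pair for each character \<open>m\<close>, and the factor of
  \<open>m\<close> is the product of the pair. The pair of \<open>m = 0\<close> is 0 and 2. Leaving out this 0, the product of
  the eigenvalues is the number of spanning trees times the number \<open>2 * n\<close> of vertices, and the factors
  2 cancel.
\<close>

theorem num_spanning_trees_I_graph:
  assumes n: "n > 0" and k: "\<not> n dvd k" and l: "\<not> n dvd l"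
  shows "of_nat n * of_nat (num_spanning_trees (I_graph n k l)) =
    (\<Prod>m = 1..<n. (3 - 2 * poly (cheb k) (cheb_node n m)) *
      (3 - 2 * poly (cheb l) (cheb_node n m)) - 1)"
proof -
  interpret finite_multigraph "I_graph n k l"
    using n by (rule finite_multigraph_I_graph)
  let ?L = "mat (n + n) (n + n)
    (\<lambda>(i, j). laplacian (I_graph n k l) (I_vertex_of n i) (I_vertex_of n j)) :: complex mat"
  define a where "a l m = 3 - complex_of_real (2 * cos (2 * pi * real (l * m) / real n))" for l m
  have a: "a l m = 3 - 2 * poly (cheb l) (cheb_node n m)" for l m
    by (simp add: a_def cheb_node_def poly_cheb_cos mult.assoc mult.left_commute)
  define R where "R = (\<Prod>m = 1..<n. [:- a l m, 1:] * [:- a k m, 1:] - 1)"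
  have "char_poly ?L = (\<Prod>m < n. [:- a l m, 1:] * [:- a k m, 1:] - 1)"
    by (rule poly_ext, subst poly_char_poly_I_graph[OF n k l])
      (simp add: poly_prod a_def algebra_simps)
  also have "{..<n} = insert 0 {1..<n}"
    using n by auto
  also have "(\<Prod>m \<in> insert 0 {1..<n}. [:- a l m, 1:] * [:- a k m, 1:] - 1) =
      ([:- a l 0, 1:] * [:- a k 0, 1:] - 1) * R"
    unfolding R_def by (rule prod.insert) auto
  \<comment> \<open>The constant character gives the eigenvalues 0 and 2.\<close>
  also have "[:- a l 0, 1:] * [:- a k 0, 1:] - 1 = [:0, 1:] * [:-2, 1:]"
    by (simp add: a_def one_pCons)
  finally have "char_poly ?L = [:0, 1:] * ([:-2, 1:] * R)"
    by (simp only: mult.assoc)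
  then have "poly (pderiv (char_poly ?L)) 0 = - 2 * poly R 0"
    by (simp add: pderiv_pCons)
  moreover have "poly (pderiv (char_poly ?L)) 0 =
      (-1) ^ (n + n - 1) * of_nat (n + n) * of_nat (num_spanning_trees (I_graph n k l))"
    by (rule pderiv_char_poly_laplacian[OF bij_betw_I_vertex_of])
  moreover have "(-1 :: complex) ^ (n + n - 1) = -1"
    using n by (cases n) auto
  ultimately have "of_nat n * of_nat (num_spanning_trees (I_graph n k l)) = poly R 0"
    by (simp add: algebra_simps)
  also have "\<dots> = (\<Prod>m = 1..<n. a k m * a l m - 1)"
    by (simp add: R_def poly_prod mult.commute)
  finally show ?thesis
    unfolding a .
qed

theorem theorem5p1:
  fixes n k l :: nat
  assumes "n > 0" "k > 0" "l > 0"
    and "gcd k l = 1"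
    and "\<not> n dvd k" "\<not> n dvd l"
  shows "degree (Q_poly k l) = k + l - 1 \<and>
    (of_nat (num_spanning_trees (I_graph n k l)) :: complex) =
      (-1) ^ ((n - 1) * (k + l)) * of_nat n *
      (\<Prod>w \<in># proots (Q_poly k l). (poly (cheb n) w - 1) / (w - 1))"
proof
  show "degree (Q_poly k l) = k + l - 1"
    using Q_poly_degree_lead_coeff(1) assms by simp
  have "of_nat n * (of_nat (num_spanning_trees (I_graph n k l)) :: complex) =
      of_nat n * ((-1) ^ ((n - 1) * (k + l)) * of_nat n *
        (\<Prod>w \<in># proots (Q_poly k l). (poly (cheb n) w - 1) / (w - 1)))"
    unfolding num_spanning_trees_I_graph[OF \<open>n > 0\<close> \<open>\<not> n dvd k\<close> \<open>\<not> n dvd l\<close>]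
      prod_Q_poly_nodes[OF \<open>n > 0\<close> \<open>k > 0\<close> \<open>l > 0\<close>]
    by (simp add: power2_eq_square)
  then show "(of_nat (num_spanning_trees (I_graph n k l)) :: complex) =
      (-1) ^ ((n - 1) * (k + l)) * of_nat n *
      (\<Prod>w \<in># proots (Q_poly k l). (poly (cheb n) w - 1) / (w - 1))"
    using \<open>n > 0\<close> by simp
qed

end
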